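(* Let $Z=\sum_{\psi\in\Psi}\lambda_\psi x_\psi\in\mathfrak a_0$ ($\lambda_\psi\in\mathbb R$) and let $\nu_1,\nu_2$ be real. Then $\mathfrak m^+_{\{\nu_1,\nu_2\}}$ is the direct sum of the restricted root spaces $\mathfrak m^+_\alpha$ over those positive restricted roots $\alpha$ satisfying $$\alpha\Big(\sum_\psi\lambda_\psi^2h_\psi\Big)=\frac{\nu_1+\nu_2}2\quad\text{and}\quad\alpha\Big(\sum_\psi\lambda_\psi^4h_\psi\Big)=\frac{\nu_1^2+6\nu_1\nu_2+\nu_2^2}8 .$$
   Context: Let $G$ be a simple complex algebraic group with commuting antiholomorphic involutions $\sigma,\theta$ (also denoting the induced involutions of $\mathfrak g$), $G_u=G^\theta$ maximal compact, $G_0=G^\sigma$, $K=G^{\sigma\theta}$, $K_0=K\cap G_0$. $\mathfrak g=\mathfrak k\oplus\mathfrak m$ is the $\pm1$-eigenspace decomposition of $\sigma\theta$, $\mathfrak m_0=\mathfrak m\cap\mathfrak g_0$. Assume $G_u/K_0$ is an irreducible Hermitian symmetric space of compact type; $\Upsilon$ is in the center of $\mathfrak k\cap\mathfrak g_0$ with $\mathrm{ad}_\Upsilon$ having eigenvalues $\pm i$ on $\mathfrak m$, eigenspaces $\mathfrak m^\pm$, $J=\mathrm{ad}_\Upsilon|_{\mathfrak m}$. Every element of $\mathfrak m_0$ is $(I+\sigma)A^+$ for a unique $A^+\in\mathfrak m^+$. Fix a $\theta$-stable Cartan subalgebra $\mathfrak t\subset\mathfrak k$ (a Cartan subalgebra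 of $\mathfrak g$; each root space lies in $\mathfrak k$, $\mathfrak m^+$ or $\mathfrak m^-$) and a maximal set $\Psi$ of strongly orthogonal roots with root spaces in $\mathfrak m^+$. For $\psi\in\Psi$ choose $e_\psi\in\mathfrak g_\psi$ such that $h_\psi=[e_\psi,\sigma e_\psi]$, $e_\psi$, $f_\psi=\sigma e_\psi$ is a standard $\mathfrak{sl}_2$-triple; $x_\psi=e_\psi+f_\psi$, $\mathfrak a_0=\mathrm{span}_{\mathbb R}\{x_\psi\}$. Let $\mathfrak t^-=\sum_\psi\mathbb Ch_\psi$; a restricted root is a nonzero restriction to $\mathfrak t^-$ of a root, and for a restricted root $\alpha$, $\mathfrak m^+_\alpha=\{X\in\mathfrak m^+:[h,X]=\alpha(h)X\ \forall h\in\mathfrak t^-\}$; positive restricted roots are those with $\mathfrak m^+_\alpha\neq0$. For $Z\in\mathfrak m_0$, $(\mathfrak m_0)_{\{\nu_1,\nu_2\}}$ is the sum of $\{A\in\mathfrak m_0:\mathrm{ad}_Z^2A=\nu_1A,\ \mathrm{ad}_{JZ}^2A=\nu_2A\}$ and $\{A\in\mathfrak m_0:\mathrm{ad}_Z^2A=\nu_2A,\ \mathrm{ad}_{JZ}^2A=\nu_1A\}$, and $\mathfrak m^+_{\{\nu_1,\nu_2\}}=\{A^+\in\mathfrak m^+:(I+\sigma)A^+\in(\mathfrak m_0)_{\{\nu_1,\nu_2\}}\}$. *)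

theory Defs
  imports "HOL-Analysis.Analysis"
begin

text \<open>Lie-algebra level rendering. The complex Lie algebra g is an abstract
  type 'g (an additive group) with a complex scalar multiplication sc and a
  bracket br; all groups in the paper only enter through their Lie algebras.\<close>

definition fin_dim_lie_algebra :: "(complex \<Rightarrow> 'g::ab_group_add \<Rightarrow> 'g) \<Rightarrow> ('g \<Rightarrow> 'g \<Rightarrow> 'g) \<Rightarrow> bool" where
  "fin_dim_lie_algebra sc br \<longleftrightarrow>
     vector_space sc \<and> (\<exists>B. finite B \<and> module.span sc B = UNIV) \<and>
     (\<forall>x y z. br (x + y) z = br x z + br y z) \<and>
     (\<forall>c x y. br (sc c x) y = sc c (br x y)) \<and>
     (\<forall>x. br x x = 0) \<and>
     (\<forall>x y z. br x (br y z) + br y (br z x) + br z (br x y) = 0)"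

definition lie_ideal :: "(complex \<Rightarrow> 'g::ab_group_add \<Rightarrow> 'g) \<Rightarrow> ('g \<Rightarrow> 'g \<Rightarrow> 'g) \<Rightarrow> 'g set \<Rightarrow> bool" where
  "lie_ideal sc br I \<longleftrightarrow> module.subspace sc I \<and> (\<forall>x y. y \<in> I \<longrightarrow> br x y \<in> I)"

definition simple_lie_algebra :: "(complex \<Rightarrow> 'g::ab_group_add \<Rightarrow> 'g) \<Rightarrow> ('g \<Rightarrow> 'g \<Rightarrow> 'g) \<Rightarrow> bool" where
  "simple_lie_algebra sc br \<longleftrightarrow> fin_dim_lie_algebra sc br \<and> (\<exists>x y. br x y \<noteq> 0) \<and>
     (\<forall>I. lie_ideal sc br I \<longrightarrow> I = {0} \<or> I = UNIV)"

text \<open>Differential of an antiholomorphic involution: an antilinear involutive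
  Lie algebra automorphism.\<close>
definition antilinear_involution :: "(complex \<Rightarrow> 'g::ab_group_add \<Rightarrow> 'g) \<Rightarrow> ('g \<Rightarrow> 'g \<Rightarrow> 'g) \<Rightarrow> ('g \<Rightarrow> 'g) \<Rightarrow> bool" where
  "antilinear_involution sc br \<phi> \<longleftrightarrow>
     (\<forall>x y. \<phi> (x + y) = \<phi> x + \<phi> y) \<and> (\<forall>c x. \<phi> (sc c x) = sc (cnj c) (\<phi> x)) \<and>
     (\<forall>x y. \<phi> (br x y) = br (\<phi> x) (\<phi> y)) \<and> (\<forall>x. \<phi> (\<phi> x) = x)"

definition lie_trace :: "(complex \<Rightarrow> 'g::ab_group_add \<Rightarrow> 'g) \<Rightarrow> ('g \<Rightarrow> 'g) \<Rightarrow> complex" where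
  "lie_trace sc f = (let B = (SOME B. finite B \<and> \<not> module.dependent sc B \<and> module.span sc B = UNIV)
     in \<Sum>b\<in>B. module.representation sc B (f b) b)"

definition killing :: "(complex \<Rightarrow> 'g::ab_group_add \<Rightarrow> 'g) \<Rightarrow> ('g \<Rightarrow> 'g \<Rightarrow> 'g) \<Rightarrow> 'g \<Rightarrow> 'g \<Rightarrow> complex" where
  "killing sc br x y = lie_trace sc (\<lambda>z. br x (br y z))"

definition compact_real_form :: "(complex \<Rightarrow> 'g::ab_group_add \<Rightarrow> 'g) \<Rightarrow> ('g \<Rightarrow> 'g \<Rightarrow> 'g) \<Rightarrow> ('g \<Rightarrow> 'g) \<Rightarrow> bool" where
  "compact_real_form sc br \<theta> \<longleftrightarrow>
     (\<forall>X. \<theta> X = X \<and> X \<noteq> 0 \<longrightarrow> killing sc br X X \<in> \<real> \<and> Re (killing sc br X X) < 0)"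

definition kk :: "('g \<Rightarrow> 'g) \<Rightarrow> ('g \<Rightarrow> 'g) \<Rightarrow> 'g set" where
  "kk \<sigma> \<theta> = {X. \<sigma> (\<theta> X) = X}"

definition mm :: "('g \<Rightarrow> 'g) \<Rightarrow> ('g \<Rightarrow> 'g) \<Rightarrow> 'g::ab_group_add set" where
  "mm \<sigma> \<theta> = {X. \<sigma> (\<theta> X) = - X}"

definition mplus :: "(complex \<Rightarrow> 'g::ab_group_add \<Rightarrow> 'g) \<Rightarrow> ('g \<Rightarrow> 'g \<Rightarrow> 'g) \<Rightarrow> ('g \<Rightarrow> 'g) \<Rightarrow> ('g \<Rightarrow> 'g) \<Rightarrow> 'g \<Rightarrow> 'g set" where
  "mplus sc br \<sigma> \<theta> \<Upsilon> = {X \<in> mm \<sigma> \<theta>. br \<Upsilon> X = sc \<i> X}"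

definition mminus :: "(complex \<Rightarrow> 'g::ab_group_add \<Rightarrow> 'g) \<Rightarrow> ('g \<Rightarrow> 'g \<Rightarrow> 'g) \<Rightarrow> ('g \<Rightarrow> 'g) \<Rightarrow> ('g \<Rightarrow> 'g) \<Rightarrow> 'g \<Rightarrow> 'g set" where
  "mminus sc br \<sigma> \<theta> \<Upsilon> = {X \<in> mm \<sigma> \<theta>. br \<Upsilon> X = sc (- \<i>) X}"

text \<open>Standing hypotheses: g simple, sigma/theta commuting antilinear involutions,
  g^theta compact, G_u/K_0 Hermitian symmetric witnessed by Upsilon in the centre
  of k \<inter> g_0 with ad_Upsilon having eigenvalues +-i on m.\<close>
definition hermitian_setup :: "(complex \<Rightarrow> 'g::ab_group_add \<Rightarrow> 'g) \<Rightarrow> ('g \<Rightarrow> 'g \<Rightarrow> 'g) \<Rightarrow> ('g \<Rightarrow> 'g) \<Rightarrow> ('g \<Rightarrow> 'g) \<Rightarrow> 'g \<Rightarrow> bool" where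
  "hermitian_setup sc br \<sigma> \<theta> \<Upsilon> \<longleftrightarrow>
     simple_lie_algebra sc br \<and> antilinear_involution sc br \<sigma> \<and> antilinear_involution sc br \<theta> \<and>
     (\<forall>X. \<sigma> (\<theta> X) = \<theta> (\<sigma> X)) \<and> compact_real_form sc br \<theta> \<and>
     \<Upsilon> \<in> kk \<sigma> \<theta> \<and> \<sigma> \<Upsilon> = \<Upsilon> \<and> (\<forall>X \<in> kk \<sigma> \<theta>. \<sigma> X = X \<longrightarrow> br \<Upsilon> X = 0) \<and>
     (\<forall>A \<in> mm \<sigma> \<theta>. br \<Upsilon> (br \<Upsilon> A) = - A) \<and>
     mplus sc br \<sigma> \<theta> \<Upsilon> \<noteq> {0} \<and> mminus sc br \<sigma> \<theta> \<Upsilon> \<noteq> {0}"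

text \<open>Cartan subalgebra (of a semisimple Lie algebra): maximal toral subalgebra,
  i.e. maximal abelian subalgebra consisting of ad-diagonalizable elements.\<close>
definition toral :: "(complex \<Rightarrow> 'g::ab_group_add \<Rightarrow> 'g) \<Rightarrow> ('g \<Rightarrow> 'g \<Rightarrow> 'g) \<Rightarrow> 'g set \<Rightarrow> bool" where
  "toral sc br S \<longleftrightarrow> module.subspace sc S \<and> (\<forall>x\<in>S. \<forall>y\<in>S. br x y = 0) \<and>
     (\<forall>h\<in>S. module.span sc {X. \<exists>c. br h X = sc c X} = UNIV)"

definition cartan_subalgebra :: "(complex \<Rightarrow> 'g::ab_group_add \<Rightarrow> 'g) \<Rightarrow> ('g \<Rightarrow> 'g \<Rightarrow> 'g) \<Rightarrow> 'g set \<Rightarrow> bool" where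
  "cartan_subalgebra sc br t \<longleftrightarrow> toral sc br t \<and> (\<forall>S. toral sc br S \<and> t \<subseteq> S \<longrightarrow> S = t)"

text \<open>Roots are represented by functions 'g => complex; only their values on
  the Cartan subalgebra t matter.\<close>
definition root_space :: "(complex \<Rightarrow> 'g::ab_group_add \<Rightarrow> 'g) \<Rightarrow> ('g \<Rightarrow> 'g \<Rightarrow> 'g) \<Rightarrow> 'g set \<Rightarrow> ('g \<Rightarrow> complex) \<Rightarrow> 'g set" where
  "root_space sc br t \<alpha> = {X. \<forall>h\<in>t. br h X = sc (\<alpha> h) X}"

definition is_root :: "(complex \<Rightarrow> 'g::ab_group_add \<Rightarrow> 'g) \<Rightarrow> ('g \<Rightarrow> 'g \<Rightarrow> 'g) \<Rightarrow> 'g set \<Rightarrow> ('g \<Rightarrow> complex) \<Rightarrow> bool" where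
  "is_root sc br t \<alpha> \<longleftrightarrow> (\<exists>h\<in>t. \<alpha> h \<noteq> 0) \<and> root_space sc br t \<alpha> \<noteq> {0}"

definition strongly_orthogonal :: "(complex \<Rightarrow> 'g::ab_group_add \<Rightarrow> 'g) \<Rightarrow> ('g \<Rightarrow> 'g \<Rightarrow> 'g) \<Rightarrow> 'g set \<Rightarrow> ('g \<Rightarrow> complex) \<Rightarrow> ('g \<Rightarrow> complex) \<Rightarrow> bool" where
  "strongly_orthogonal sc br t \<alpha> \<beta> \<longleftrightarrow>
     (\<exists>h\<in>t. \<alpha> h \<noteq> \<beta> h) \<and> (\<exists>h\<in>t. \<alpha> h \<noteq> - \<beta> h) \<and>
     \<not> is_root sc br t (\<lambda>h. \<alpha> h + \<beta> h) \<and> \<not> is_root sc br t (\<lambda>h. \<alpha> h - \<beta> h)"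

definition max_strongly_orthogonal_set :: "(complex \<Rightarrow> 'g::ab_group_add \<Rightarrow> 'g) \<Rightarrow> ('g \<Rightarrow> 'g \<Rightarrow> 'g) \<Rightarrow> 'g set \<Rightarrow> 'g set \<Rightarrow> ('g \<Rightarrow> complex) set \<Rightarrow> bool" where
  "max_strongly_orthogonal_set sc br t P \<Psi> \<longleftrightarrow>
     (\<forall>\<psi>\<in>\<Psi>. is_root sc br t \<psi> \<and> root_space sc br t \<psi> \<subseteq> P) \<and>
     (\<forall>\<psi>\<in>\<Psi>. \<forall>\<psi>'\<in>\<Psi>. \<psi> \<noteq> \<psi>' \<longrightarrow> strongly_orthogonal sc br t \<psi> \<psi>') \<and>
     (\<forall>\<beta>. is_root sc br t \<beta> \<and> root_space sc br t \<beta> \<subseteq> P \<and> \<beta> \<notin> \<Psi> \<longrightarrow>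
        \<not> (\<forall>\<psi>\<in>\<Psi>. strongly_orthogonal sc br t \<beta> \<psi>))"

definition restricted_root :: "(complex \<Rightarrow> 'g::ab_group_add \<Rightarrow> 'g) \<Rightarrow> ('g \<Rightarrow> 'g \<Rightarrow> 'g) \<Rightarrow> 'g set \<Rightarrow> 'g set \<Rightarrow> ('g \<Rightarrow> complex) \<Rightarrow> bool" where
  "restricted_root sc br t tm \<alpha> \<longleftrightarrow>
     (\<exists>\<beta>. is_root sc br t \<beta> \<and> (\<forall>h\<in>tm. \<alpha> h = \<beta> h)) \<and> (\<exists>h\<in>tm. \<alpha> h \<noteq> 0)"

definition restricted_space :: "(complex \<Rightarrow> 'g::ab_group_add \<Rightarrow> 'g) \<Rightarrow> ('g \<Rightarrow> 'g \<Rightarrow> 'g) \<Rightarrow> 'g set \<Rightarrow> 'g set \<Rightarrow> ('g \<Rightarrow> complex) \<Rightarrow> 'g set" where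
  "restricted_space sc br P tm \<alpha> = {X \<in> P. \<forall>h\<in>tm. br h X = sc (\<alpha> h) X}"

definition m0_joint :: "(complex \<Rightarrow> 'g::ab_group_add \<Rightarrow> 'g) \<Rightarrow> ('g \<Rightarrow> 'g \<Rightarrow> 'g) \<Rightarrow> 'g set \<Rightarrow> 'g \<Rightarrow> 'g \<Rightarrow> real \<Rightarrow> real \<Rightarrow> 'g set" where
  "m0_joint sc br M0 Z JZ a b =
     {A \<in> M0. br Z (br Z A) = sc (complex_of_real a) A \<and> br JZ (br JZ A) = sc (complex_of_real b) A}"

definition m0_nu :: "(complex \<Rightarrow> 'g::ab_group_add \<Rightarrow> 'g) \<Rightarrow> ('g \<Rightarrow> 'g \<Rightarrow> 'g) \<Rightarrow> 'g set \<Rightarrow> 'g \<Rightarrow> 'g \<Rightarrow> real \<Rightarrow> real \<Rightarrow> 'g set" where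
  "m0_nu sc br M0 Z JZ \<nu>1 \<nu>2 =
     {A1 + A2 | A1 A2. A1 \<in> m0_joint sc br M0 Z JZ \<nu>1 \<nu>2 \<and> A2 \<in> m0_joint sc br M0 Z JZ \<nu>2 \<nu>1}"

end

theory Submission
  imports Defs
begin

text \<open>Write \<open>Z = p + q\<close> with \<open>p = \<Sum>\<lambda>\<^sub>\<psi> e\<^sub>\<psi>\<close> in \<open>\<mm>\<^sup>+\<close> and \<open>q = \<sigma> p\<close> in \<open>\<mm>\<^sup>-\<close>. Since \<open>\<mm>\<^sup>+\<close> and \<open>\<mm>\<^sup>-\<close> are
  abelian, \<open>ad\<^sub>Z\<^sup>2\<close> and \<open>ad\<^sub>J\<^sub>Z\<^sup>2\<close> act on \<open>\<mm>\<^sup>+\<close> as \<open>D + C\<close> and \<open>D - C\<close>, where \<open>D\<close> is the bracket with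
  \<open>[p, q] = \<Sum>\<lambda>\<^sub>\<psi>\<^sup>2 h\<^sub>\<psi>\<close> and \<open>C A = [p, [p, \<sigma> A]]\<close> is antilinear. The commutation relations give
  \<open>C\<^sup>2 = 2 (D\<^sup>2 - D')\<close> with \<open>D'\<close> the bracket with \<open>\<Sum>\<lambda>\<^sub>\<psi>\<^sup>4 h\<^sub>\<psi>\<close>, so the eigenvalue conditions on
  \<open>ad\<^sub>Z\<^sup>2\<close> and \<open>ad\<^sub>J\<^sub>Z\<^sup>2\<close> translate into eigenvalue conditions on \<open>D\<close> and \<open>D'\<close>, provided \<open>C\<close>
  preserves their joint eigenspaces and vanishes where \<open>C\<^sup>2\<close> does. Both follow from a weight
  computation: if \<open>f\<^sub>i f\<^sub>j Y \<noteq> 0\<close> for a weight vector \<open>Y\<close> of \<open>\<mm>\<^sup>+\<close>, then \<open>h\<^sub>k\<close> acts on \<open>Y\<close> by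
  \<open>\<delta>\<^sub>k\<^sub>i + \<delta>\<^sub>k\<^sub>j\<close>.\<close>

section \<open>Lie algebras with a bracket linear in the first argument\<close>

text \<open>The definition \<open>fin_dim_lie_algebra\<close> requires linearity of the bracket only in its first
  argument, together with \<open>[x, x] = 0\<close> and the Jacobi identity. This does not imply bilinearity in
  general, but double brackets turn out to be trilinear, and this suffices for antisymmetry once
  \<open>[z, [n, y]] = 0\<close> for all \<open>z\<close>, \<open>y\<close> forces \<open>n = 0\<close>. The compact real form provides that.\<close>

locale left_lie_algebra = vector_space sc
  for sc :: "complex \<Rightarrow> 'g::ab_group_add \<Rightarrow> 'g" +
  fixes br :: "'g \<Rightarrow> 'g \<Rightarrow> 'g"
  assumes br_add_left: "br (x + y) z = br x z + br y z"
    and br_scale_left: "br (sc c x) y = sc c (br x y)"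
    and br_self [simp]: "br x x = 0"
    and jacobi: "br x (br y z) + br y (br z x) + br z (br x y) = 0"
begin

lemma double_eq_0: "x + x = 0 \<Longrightarrow> x = (0::'g)"
proof -
  assume "x + x = 0"
  then have "sc (1 + 1) x = 0" unfolding scale_left_distrib by simp
  then show ?thesis by simp
qed

lemma br_minus_left: "br (- x) y = - br x y"
  using br_scale_left[of "-1" x y] by simp

lemma br_0_right [simp]: "br x 0 = 0"
proof -
  have "br x 0 + br x 0 + br x 0 = 0" using jacobi[of x x x] by simp
  then have "sc (1 + 1 + 1) (br x 0) = 0" unfolding scale_left_distrib by simp
  then show ?thesis by simp
qed

lemma br_br_cyclic: "br x (br y z) = - br y (br z x) - br z (br x y)"
  using jacobi[of x y z] by (simp add: algebra_simps eq_neg_iff_add_eq_0)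

text \<open>The additivity defect of the double bracket is additive in \<open>y\<close> by the Jacobi identity
  and vanishes for \<open>y = x\<close>, hence is antisymmetric in \<open>y\<close>, \<open>x\<close>. Being symmetric in \<open>x\<close>, \<open>x'\<close>,
  it is zero.\<close>
lemma br_br_add_middle: "br z (br (x + x') y) = br z (br x y) + br z (br x' y)"
proof -
  define B where "B y x x' = br z (br x y + br x' y) - br z (br x y) - br z (br x' y)" for y x x'
  have B_eq: "B y x x' = - (br y (br z (x + x')) - br y (br z x) - br y (br z x'))" for y x x'
    using br_br_cyclic[of z "x + x'" y] br_br_cyclic[of z x y] br_br_cyclic[of z x' y]
    unfolding B_def by (simp add: br_add_left)
  have B_add: "B (y + y') x x' = B y x x' + B y' x x'" for y y' x x'
    unfolding B_eq by (simp add: br_add_left)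
  have B_diag: "B x x x' = 0" for x x'
    unfolding B_def by simp
  have B_anti: "B x y x' = - B y x x'" for x y x'
  proof -
    have "0 = B (x + y) (x + y) x'" by (simp add: B_diag)
    also have "\<dots> = B x (x + y) x' + B y (x + y) x'" by (rule B_add)
    also have "B x (x + y) x' = B x y x'" unfolding B_def by (simp add: br_add_left)
    also have "B y (x + y) x' = B y x x'" unfolding B_def by (simp add: br_add_left)
    finally show ?thesis by (simp add: eq_neg_iff_add_eq_0)
  qed
  have B_sym: "B y x x' = B y x' x" for y x x'
    unfolding B_def by (simp add: add.commute algebra_simps)
  have "B y x x' = - B y x x'"
    by (metis B_anti B_sym minus_minus)
  then have "B y x x' = 0" using double_eq_0[of "B y x x'"] by (simp add: eq_neg_iff_add_eq_0)
  then show ?thesis unfolding B_def by (simp add: br_add_left algebra_simps)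
qed

text \<open>The Jacobi identity moves the sum out of the last slot into the outer and middle slots,
  where additivity is known.\<close>

lemma br_br_add_right: "br y (br z (x + x')) = br y (br z x) + br y (br z x')"
  using br_br_cyclic[of y z "x + x'"] br_br_cyclic[of y z x] br_br_cyclic[of y z x']
    br_br_add_middle[of z x x' y]
  by (simp add: br_add_left)

lemma br_br_anti: "br z (br x y) = - br z (br y x)"
proof -
  have "br z (br (x + y) (x + y)) = br z (br x y) + br z (br y x)"
    by (simp only: br_br_add_middle br_br_add_right) simp
  then show ?thesis by (simp add: eq_neg_iff_add_eq_0)
qed

text \<open>The homogeneity defect \<open>H\<close> is antisymmetric in its first two arguments,
  because it vanishes on the diagonal, and symmetric in the last two by the Jacobi identity.
  Alternating the two exchanges returns to the start with the opposite sign.\<close>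

lemma br_br_scale_middle: "br z (br (sc c x) y) = sc c (br z (br x y))"
proof -
  define H where "H x y z = br z (br (sc c x) y) - sc c (br z (br x y))" for x y z
  have diag: "H x x z = 0" for x z
    unfolding H_def by (simp add: br_scale_left)
  have anti: "H x y z = - H y x z" for x y z
  proof -
    have "0 = H (x + y) (x + y) z" by (rule diag[symmetric])
    also have "\<dots> = H x (x + y) z + H y (x + y) z"
      unfolding H_def scale_right_distrib[of c x y] br_br_add_middle scale_right_distrib by simp
    also have "H x (x + y) z = H x x z + H x y z"
      unfolding H_def by (simp add: br_br_add_right scale_right_distrib)
    also have "H y (x + y) z = H y x z + H y y z"
      unfolding H_def by (simp add: br_br_add_right scale_right_distrib)
    finally show ?thesis by (simp add: diag eq_neg_iff_add_eq_0)
  qed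
  have sym: "H x y z = H x z y" for x y z
    using br_br_cyclic[of "sc c x" y z] br_br_cyclic[of x y z]
      br_br_anti[of y z "sc c x"] br_br_anti[of y z x]
    unfolding H_def by (simp add: br_scale_left algebra_simps)
  have "H x y z = - H x y z"
    by (metis anti sym minus_minus)
  then have "H x y z = 0" using double_eq_0[of "H x y z"] by (simp add: eq_neg_iff_add_eq_0)
  then show ?thesis unfolding H_def by simp
qed

text \<open>The element \<open>br x y + br y x\<close> is killed by all double brackets, since
  antisymmetry already holds under an outer bracket.\<close>

lemma br_antisym:
  assumes faithful: "\<And>n. (\<And>z y. br z (br n y) = 0) \<Longrightarrow> n = 0"
  shows "br x y = - br y x"
proof -
  have minus_right: "br z (- br u v) = - br z (br u v)" for z u v
    using br_br_scale_middle[of z "-1" u v] by (simp add: br_minus_left)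
  have "br z (br (br x y + br y x) w) = 0" for z w
  proof -
    have "br z (br w (br y x)) = br z (- br w (br x y))"
      by (simp add: br_br_anti[of w y x])
    then have "br z (br w (br x y + br y x)) = 0"
      unfolding br_br_add_right minus_right by simp
    then show ?thesis
      using br_br_anti[of z "br x y + br y x" w] by simp
  qed
  then show ?thesis using faithful eq_neg_iff_add_eq_0 by blast
qed
end

section \<open>Simultaneous diagonalization\<close>

locale lie_algebra = left_lie_algebra +
  assumes br_anti: "br x y = - br y x"
    and finite_dim: "\<exists>B. finite B \<and> span B = UNIV"
begin

lemma br_add_right: "br x (y + z) = br x y + br x z"
  using br_anti[of x] by (simp add: br_add_left)

lemma br_scale_right: "br x (sc c y) = sc c (br x y)"
  using br_anti[of x] by (simp add: br_scale_left)

lemma br_minus_right: "br x (- y) = - br x y"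
  using br_scale_right[of x "-1" y] by simp

lemma br_0_left [simp]: "br 0 x = 0"
  using br_scale_left[of 0 0 x] by simp

lemma br_diff_left: "br (x - y) z = br x z - br y z"
  using br_add_left[of x "- y" z] by (simp add: br_minus_left)

lemma br_diff_right: "br x (y - z) = br x y - br x z"
  using br_add_right[of x y "- z"] by (simp add: br_minus_right)

lemma br_sum_left: "br (\<Sum>i\<in>I. f i) x = (\<Sum>i\<in>I. br (f i) x)"
  by (induction I rule: infinite_finite_induct) (simp_all add: br_add_left)

lemma br_sum_right: "br x (\<Sum>i\<in>I. f i) = (\<Sum>i\<in>I. br x (f i))"
  by (induction I rule: infinite_finite_induct) (simp_all add: br_add_right)

lemmas br_linear = br_add_left br_add_right br_diff_left br_diff_right br_minus_left br_minus_right
  br_scale_left br_scale_right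

lemma br_br_left: "br (br x y) z = br x (br y z) - br y (br x z)"
  using br_br_cyclic[of x y z] br_anti[of z x] br_anti[of z "br x y"]
  by (simp add: br_minus_right)

lemma br_commute_if: "br x y = 0 \<Longrightarrow> br x (br y z) = br y (br x z)"
  using br_br_left[of x y z] by simp

lemma sc_numeral_expand:
  "sc 2 x = x + x" "sc 3 x = x + x + x" "sc 4 x = x + x + x + x"
proof -
  have "sc (1 + 1) x = x + x" "sc (1 + 1 + 1) x = x + x + x" "sc (1 + 1 + 1 + 1) x = x + x + x + x"
    unfolding scale_left_distrib by simp_all
  then show "sc 2 x = x + x" "sc 3 x = x + x + x" "sc 4 x = x + x + x + x"
    by (simp_all only: one_add_one numeral_plus_one add_num_simps)
qed

text \<open>The distinct-eigenvalue argument, where each pair of weights may be separated by its own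
  element of \<open>H\<close>. For \<open>W = {0}\<close> it says that weight vectors of distinct
  weights are independent.\<close>

lemma weight_components_in_subspace:
  assumes "finite I" and W: "subspace W" and inv: "\<And>h w. h \<in> H \<Longrightarrow> w \<in> W \<Longrightarrow> br h w \<in> W"
    and "\<And>i h. i \<in> I \<Longrightarrow> h \<in> H \<Longrightarrow> br h (v i) = sc (c i h) (v i)"
    and "\<And>i j. i \<in> I \<Longrightarrow> j \<in> I \<Longrightarrow> i \<noteq> j \<Longrightarrow> \<exists>h\<in>H. c i h \<noteq> c j h"
    and "(\<Sum>i\<in>I. v i) \<in> W"
  shows "\<forall>i\<in>I. v i \<in> W"
  using assms(1,4-6)
proof (induction I arbitrary: v rule: finite_induct)
  case (insert a I)
  have "v i \<in> W" if i: "i \<in> I" for i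
  proof -
    obtain h where h: "h \<in> H" "c i h \<noteq> c a h"
      using insert.prems(2)[of i a] insert.hyps(2) i by auto
    \<comment> \<open>Applying \<open>h\<close> minus its eigenvalue on \<open>v a\<close> removes
      \<open>v a\<close>, and the coefficient of \<open>v i\<close> stays nonzero by the choice of
      \<open>h\<close>.\<close>
    define u where "u j = sc (c j h - c a h) (v j)" for j
    have "br h (\<Sum>j\<in>insert a I. v j) - sc (c a h) (\<Sum>j\<in>insert a I. v j) \<in> W"
      using insert.prems(3) h(1) by (intro subspace_diff W inv subspace_scale)
    also have "br h (\<Sum>j\<in>insert a I. v j) = (\<Sum>j\<in>insert a I. sc (c j h) (v j))"
      unfolding br_sum_right using insert.prems(1) h(1) by (intro sum.cong) auto
    also have "\<dots> - sc (c a h) (\<Sum>j\<in>insert a I. v j) = (\<Sum>j\<in>insert a I. u j)"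
      unfolding u_def scale_left_diff_distrib sum_subtractf scale_sum_right ..
    also have "\<dots> = (\<Sum>j\<in>I. u j)"
      using insert.hyps by (simp add: u_def)
    finally have "\<forall>j\<in>I. u j \<in> W"
      using insert.prems(1,2)
      by (intro insert.IH) (auto simp: u_def br_scale_right scale_left_commute)
    then have "sc (inverse (c i h - c a h)) (u i) \<in> W"
      using i W by (blast intro: subspace_scale)
    then show ?thesis using h(2) by (simp add: u_def)
  qed
  moreover have "v a = (\<Sum>j\<in>insert a I. v j) - (\<Sum>j\<in>I. v j)"
    using insert.hyps by simp
  then have "v a \<in> W"
    using insert.prems(3) calculation W by (metis subspace_diff subspace_sum)
  ultimately show ?case by blast
qed simp

definition eigvecs :: "'a \<Rightarrow> 'a set"
  where "eigvecs h = {X. \<exists>c. br h X = sc c X}"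

text \<open>Expand \<open>w\<close> in eigenvectors and group them by eigenvalue; invariance then
  forces every group into \<open>W\<close>.\<close>

lemma invariant_subspace_span_eigvecs:
  assumes diag: "span (eigvecs h) = UNIV" and W: "subspace W"
    and inv: "\<And>w. w \<in> W \<Longrightarrow> br h w \<in> W"
  shows "W \<subseteq> span (W \<inter> eigvecs h)"
proof
  fix w assume w: "w \<in> W"
  have "w \<in> span (eigvecs h)" using diag by simp
  then obtain T r where T: "finite T" "T \<subseteq> eigvecs h" and w_eq: "w = (\<Sum>x\<in>T. sc (r x) x)"
    unfolding span_explicit by blast
  have "\<forall>x\<in>T. \<exists>c. br h x = sc c x"
    using T(2) by (auto simp: eigvecs_def)
  then obtain ev where ev: "\<forall>x\<in>T. br h x = sc (ev x) x"
    by (rule bchoice[THEN exE])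
  define v where "v c = (\<Sum>x\<in>{x \<in> T. ev x = c}. sc (r x) x)" for c
  have sum_v: "w = (\<Sum>c\<in>ev ` T. v c)"
    unfolding w_eq v_def using T(1) by (rule sum.image_gen)
  have v_eig: "br h (v c) = sc c (v c)" for c
    unfolding v_def br_sum_right scale_sum_right
    by (intro sum.cong) (auto simp: br_scale_right ev scale_left_commute)
  have "\<forall>c\<in>ev ` T. v c \<in> W"
    by (rule weight_components_in_subspace[where H = "{h}" and c = "\<lambda>c _. c"])
      (use T(1) W inv v_eig sum_v w in auto)
  then have "v c \<in> span (W \<inter> eigvecs h)" if "c \<in> ev ` T" for c
    using that v_eig[of c] by (intro span_base) (auto simp: eigvecs_def)
  then show "w \<in> span (W \<inter> eigvecs h)"
    unfolding sum_v by (intro span_sum) auto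
qed

text \<open>Induction on \<open>H\<close>: since \<open>k\<close> commutes with \<open>H\<close>, it
  preserves each joint weight space \<open>V\<close> of \<open>H\<close> in \<open>W\<close>, so the
  case of a single element splits \<open>V\<close> further.\<close>

lemma invariant_subspace_span_joint_eigvecs:
  assumes "finite H" and "\<And>h. h \<in> H \<Longrightarrow> span (eigvecs h) = UNIV"
    and "\<And>h k. h \<in> H \<Longrightarrow> k \<in> H \<Longrightarrow> br h k = 0"
    and "subspace W" and "\<And>h w. h \<in> H \<Longrightarrow> w \<in> W \<Longrightarrow> br h w \<in> W"
  shows "W \<subseteq> span (W \<inter> (\<Inter>h\<in>H. eigvecs h))"
  using assms(1-3,5)
proof (induction H rule: finite_induct)
  case empty
  then show ?case by (simp add: span_superset)
next
  case (insert k H)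
  let ?J = "W \<inter> (\<Inter>h\<in>insert k H. eigvecs h)"
  have "X \<in> span ?J" if X: "X \<in> W \<inter> (\<Inter>h\<in>H. eigvecs h)" for X
  proof -
    obtain c where c: "\<And>h. h \<in> H \<Longrightarrow> br h X = sc (c h) X"
      using X unfolding eigvecs_def by simp metis
    define V where "V = {Y \<in> W. \<forall>h\<in>H. br h Y = sc (c h) Y}"
    have "subspace V"
      using assms(4) unfolding V_def subspace_def
      by (auto simp: br_linear scale_right_distrib scale_left_commute)
    moreover have "br k Y \<in> V" if "Y \<in> V" for Y
    proof -
      have "br h (br k Y) = br k (br h Y)" if "h \<in> H" for h
        using insert.prems(2)[of h k] that by (intro br_commute_if) auto
      then show ?thesis
        using that insert.prems(3)[of k Y] unfolding V_def by (auto simp: br_scale_right)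
    qed
    ultimately have "V \<subseteq> span (V \<inter> eigvecs k)"
      using insert.prems(1)[of k] by (intro invariant_subspace_span_eigvecs) auto
    also have "\<dots> \<subseteq> span ?J"
      by (intro span_mono) (auto simp: V_def eigvecs_def)
    finally show ?thesis using X c unfolding V_def by auto
  qed
  then have "span (W \<inter> (\<Inter>h\<in>H. eigvecs h)) \<subseteq> span ?J"
    by (intro span_minimal) auto
  moreover have "W \<subseteq> span (W \<inter> (\<Inter>h\<in>H. eigvecs h))"
    using insert.prems by (intro insert.IH) auto
  ultimately show ?case by blast
qed

text \<open>A finite basis of \<open>t\<close> is diagonalized jointly. This suffices because the
  elements that have a given \<open>X\<close> as eigenvector form a subspace.\<close>

lemma toral_span_weight_vectors:
  assumes "toral sc br t" and "subspace W" and "\<And>h w. h \<in> t \<Longrightarrow> w \<in> W \<Longrightarrow> br h w \<in> W"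
  shows "W \<subseteq> span {X \<in> W. \<exists>\<beta>. X \<in> root_space sc br t \<beta>}"
proof -
  have t: "subspace t" "\<And>h k. h \<in> t \<Longrightarrow> k \<in> t \<Longrightarrow> br h k = 0"
      "\<And>h. h \<in> t \<Longrightarrow> span (eigvecs h) = UNIV"
    using assms(1) unfolding toral_def eigvecs_def by auto
  obtain B where B: "B \<subseteq> t" "independent B" "t \<subseteq> span B"
    using maximal_independent_subset by blast
  have "finite B"
    using finite_dim B(2) independent_span_bound by (metis subset_UNIV)
  then have "W \<subseteq> span (W \<inter> (\<Inter>h\<in>B. eigvecs h))"
    by (rule invariant_subspace_span_joint_eigvecs)
      (fact t(3)[OF subsetD[OF B(1)]] t(2)[OF subsetD[OF B(1)] subsetD[OF B(1)]]
        assms(2) assms(3)[OF subsetD[OF B(1)]])+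
  also have "W \<inter> (\<Inter>h\<in>B. eigvecs h) \<subseteq> {X \<in> W. \<exists>\<beta>. X \<in> root_space sc br t \<beta>}"
  proof safe
    fix X assume X: "X \<in> (\<Inter>h\<in>B. eigvecs h)"
    have "subspace {h. X \<in> eigvecs h}"
      unfolding subspace_def eigvecs_def
      by (auto simp: br_linear scale_left_distrib[symmetric] intro: exI[of _ 0])
    then have "span B \<subseteq> {h. X \<in> eigvecs h}"
      using X by (intro span_minimal) auto
    then have "\<forall>h\<in>t. \<exists>c. br h X = sc c X"
      using B(3) unfolding eigvecs_def by auto
    then show "\<exists>\<beta>. X \<in> root_space sc br t \<beta>"
      unfolding root_space_def by simp metis
  qed
  finally show ?thesis by (simp add: span_mono)
qed

text \<open>The sum \<open>S\<close> of \<open>t\<close> and the line through \<open>y\<close> is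
  again toral, so maximality gives \<open>S = t\<close>. This later places \<Upsilon> and the
  coroots \<open>h \<psi>\<close> in \<open>t\<close>.\<close>

lemma diagonalizable_commuting_in_cartan:
  assumes cartan: "cartan_subalgebra sc br t" and comm: "\<And>h. h \<in> t \<Longrightarrow> br h y = 0"
    and diag: "span (eigvecs y) = UNIV"
  shows "y \<in> t"
proof -
  have t: "subspace t" "\<And>h k. h \<in> t \<Longrightarrow> k \<in> t \<Longrightarrow> br h k = 0"
      "\<And>h. h \<in> t \<Longrightarrow> span (eigvecs h) = UNIV"
    using cartan unfolding cartan_subalgebra_def toral_def eigvecs_def by auto
  have comm': "br y h = 0" if "h \<in> t" for h
    using comm[OF that] br_anti[of y h] by simp
  define S where "S = {h + sc c y | h c. h \<in> t}"
  have "subspace S"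
    unfolding subspace_def
  proof safe
    show "0 \<in> S" unfolding S_def using subspace_0[OF t(1)] by (force intro: exI[of _ 0])
  next
    fix a b assume "a \<in> S" "b \<in> S"
    then obtain h c k d where "a = h + sc c y" "b = k + sc d y" "h \<in> t" "k \<in> t"
      unfolding S_def by blast
    then have "a + b = (h + k) + sc (c + d) y" "h + k \<in> t"
      using subspace_add[OF t(1)] by (auto simp: scale_left_distrib algebra_simps)
    then show "a + b \<in> S" unfolding S_def by blast
  next
    fix d a assume "a \<in> S"
    then obtain h c where "a = h + sc c y" "h \<in> t" unfolding S_def by blast
    then have "sc d a = sc d h + sc (d * c) y" "sc d h \<in> t"
      using subspace_scale[OF t(1)] by (auto simp: scale_right_distrib)
    then show "sc d a \<in> S" unfolding S_def by blast
  qed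
  moreover have "br a b = 0" if "a \<in> S" "b \<in> S" for a b
    using that t(2) comm comm' unfolding S_def by (auto simp: br_linear)
  moreover have "span (eigvecs a) = UNIV" if aS: "a \<in> S" for a
  proof -
    obtain h c where a: "a = h + sc c y" and h: "h \<in> t" using aS unfolding S_def by blast
    have "UNIV \<subseteq> span (UNIV \<inter> (\<Inter>k\<in>{h, y}. eigvecs k))"
      using h t diag comm[OF h] comm'[OF h]
      by (intro invariant_subspace_span_joint_eigvecs) auto
    also have "\<dots> \<subseteq> span (eigvecs a)"
      by (intro span_mono) (auto simp: a eigvecs_def br_linear scale_left_distrib[symmetric])
    finally show ?thesis by auto
  qed
  ultimately have "toral sc br S"
    unfolding toral_def eigvecs_def by blast
  moreover have "t \<subseteq> S"
    unfolding S_def by (force intro: exI[of _ 0])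
  ultimately have "S = t"
    using cartan unfolding cartan_subalgebra_def by blast
  moreover have "y \<in> S"
    unfolding S_def using subspace_0[OF t(1)] by (force intro: exI[of _ 1])
  ultimately show ?thesis by simp
qed

end

section \<open>Triples spanning a copy of sl(2)\<close>

locale sl2_triple = lie_algebra +
  fixes e h f :: 'a
  assumes br_h_e: "br h e = sc 2 e" and br_h_f: "br h f = sc (- 2) f" and br_e_f: "br e f = h"
begin

lemma swap_e_f: "br e (br f X) = br f (br e X) + br h X"
  using br_br_left[of e f X] by (simp add: br_e_f)

lemma swap_e_h: "br e (br h X) = br h (br e X) - (br e X + br e X)"
  using br_br_left[of h e X] by (simp add: br_h_e br_linear sc_numeral_expand algebra_simps)

lemma swap_h_f: "br h (br f X) = br f (br h X) - (br f X + br f X)"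
  using br_br_left[of h f X] by (simp add: br_h_f br_linear sc_numeral_expand algebra_simps)

lemmas swap = swap_e_f swap_e_h swap_h_f

text \<open>Each application of \<open>e\<close> to a power of \<open>f\<close> lowers the power by
  one and leaves a factor in \<open>h\<close>. Starting from \<open>f^3 A = 0\<close>, three
  applications give \<open>h (h - 1) (h - 2) A = 0\<close>, without \<open>A\<close> being an
  eigenvector of \<open>h\<close>.\<close>

lemma highest_weight_cubic:
  assumes e0: "br e A = 0" and f3: "br f (br f (br f A)) = 0"
  shows "br h (br h (br h A)) = sc 3 (br h (br h A)) - sc 2 (br h A)"
proof -
  define A1 where "A1 = br h A - (A + A)"
  define A2 where "A2 = br h A1 - A1"
  have eA1: "br e A1 = 0" and eA2: "br e A2 = 0"
    unfolding A2_def A1_def by (simp_all add: br_linear swap e0)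
  have "br e (br f (br f (br f A))) = sc 3 (br f (br f A1))"
    unfolding A1_def by (simp add: br_linear swap e0 sc_numeral_expand algebra_simps)
  then have f2: "br f (br f A1) = 0" using f3 by simp
  have "br e (br f (br f A1)) = sc 2 (br f A2)"
    unfolding A2_def by (simp add: br_linear swap eA1 sc_numeral_expand algebra_simps)
  then have f1: "br f A2 = 0" using f2 by simp
  have "br h A2 = 0"
    using swap_e_f[of A2] eA2 f1 by simp
  then show ?thesis
    unfolding A2_def A1_def by (simp add: br_linear sc_numeral_expand algebra_simps)
qed

text \<open>The identity \<open>key\<close> is \<open>e\<^sup>2 f\<^sup>2 Y = 0\<close> in normal order. Its instances for \<open>X\<close>, \<open>f e X\<close> and
  \<open>h X\<close> are linear relations from which \<open>f e X\<close>, \<open>f h e X\<close> and \<open>f h\<^sup>2 e X\<close> can be eliminated.\<close>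
lemma short_weight_cubic:
  assumes e2: "br e (br e X) = 0" and f2: "br f (br f X) = 0"
  shows "br h (br h (br h X)) = br h X"
proof -
  have key: "sc 2 (br f (br h (br e Y))) = sc 4 (br f (br e Y)) + br h Y - br h (br h Y)"
    if Y: "br e (br e Y) = 0" "br f (br f Y) = 0" for Y
  proof -
    have "0 = br e (br e (br f (br f Y)))" by (simp add: Y(2))
    also have "\<dots> = sc 2 (sc 2 (br f (br h (br e Y))) - sc 4 (br f (br e Y)) - br h Y + br h (br h Y))"
      by (simp add: br_linear swap Y(1) sc_numeral_expand algebra_simps)
    finally have "sc 2 (br f (br h (br e Y))) - sc 4 (br f (br e Y)) - br h Y + br h (br h Y) = 0"
      by simp
    then show ?thesis by (simp add: algebra_simps add_eq_0_iff2)
  qed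
  have f2e: "br f (br f (br e X)) = sc 2 (br f X) - sc 2 (br f (br h X))"
  proof -
    have "0 = br e (br f (br f X))" by (simp add: f2)
    also have "\<dots> = br f (br f (br e X)) - (sc 2 (br f X) - sc 2 (br f (br h X)))"
      by (simp add: br_linear swap sc_numeral_expand algebra_simps)
    finally show ?thesis by simp
  qed
  have f2h: "br f (br f (br h X)) = 0"
  proof -
    have "br h (br f (br f X)) = br f (br f (br h X)) - sc 4 (br f (br f X))"
      by (simp add: br_linear swap sc_numeral_expand algebra_simps)
    then show ?thesis by (simp add: f2)
  qed
  have K1: "sc 2 (br f (br h (br e X))) = sc 4 (br f (br e X)) + br h X - br h (br h X)"
    by (rule key) (fact e2 f2)+
  have K2: "sc 2 (br f (br h (br e (br f (br e X))))) =
      sc 4 (br f (br e (br f (br e X)))) + br h (br f (br e X)) - br h (br h (br f (br e X)))"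
    by (rule key) (simp_all add: br_linear swap e2 f2e f2 f2h)
  have K3: "sc 2 (br f (br h (br e (br h X)))) =
      sc 4 (br f (br e (br h X))) + br h (br h X) - br h (br h (br h X))"
    by (rule key) (simp_all add: br_linear swap e2 f2h)
  define a where "a = br f (br e X)"
  define b where "b = br f (br h (br e X))"
  define c where "c = br f (br h (br h (br e X)))"
  have L2: "c + c - (b + b + b + b + (b - a - a) - (c - b - b - b - b + a + a + a + a)) = 0"
    using K2 unfolding a_def b_def c_def
    by (simp add: br_linear swap e2 sc_numeral_expand algebra_simps)
  have L3: "c + c - (b + b + b + b) -
      (b + b + b + b - (a + a + a + a + a + a + a + a) + br h (br h X) - br h (br h (br h X))) = 0"
    using K3 unfolding a_def b_def c_def
    by (simp add: br_linear swap e2 sc_numeral_expand algebra_simps)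
  have L1: "b + b - (a + a + a + a + br h X - br h (br h X)) = 0"
    using K1 unfolding a_def b_def by (simp add: sc_numeral_expand)
  \<comment> \<open>The coefficients 3, -2, 3 are those for which \<open>a\<close>, \<open>b\<close>
    and \<open>c\<close> cancel.\<close>
  have "sc 3 (br h (br h (br h X)) - br h X) =
      sc 3 (b + b - (a + a + a + a + br h X - br h (br h X)))
    - sc 2 (c + c - (b + b + b + b + (b - a - a) - (c - b - b - b - b + a + a + a + a)))
    + sc 3 (c + c - (b + b + b + b) -
      (b + b + b + b - (a + a + a + a + a + a + a + a) + br h (br h X) - br h (br h (br h X))))"
    by (simp add: sc_numeral_expand algebra_simps)
  also have "\<dots> = 0" by (simp only: L1 L2 L3) simp
  finally show ?thesis by simp
qed

end

section \<open>Diagonalizability from cubic identities\<close>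

context lie_algebra
begin

lemma eigvecsI: "br h X = sc c X \<Longrightarrow> X \<in> eigvecs h"
  unfolding eigvecs_def by blast

lemma half_double: "sc (1 / 2) (X + X) = X"
  by (simp only: sc_numeral_expand(1)[symmetric] scale_scale) simp

lemma span_double: "X + X \<in> span S \<Longrightarrow> X \<in> span S"
  by (drule span_scale[of _ _ "1 / 2"]) (simp only: half_double)

text \<open>Lagrange interpolation at 0, 1, 2: the vectors are \<open>(h - 1) (h - 2) X\<close>,
  \<open>- 2 h (h - 2) X\<close> and \<open>h (h - 1) X\<close>, whose sum is
  \<open>2 X\<close>.\<close>

lemma span_eigvecs_cubic_012:
  assumes "br h (br h (br h X)) = sc 3 (br h (br h X)) - sc 2 (br h X)"
  shows "X \<in> span (eigvecs h)"
proof -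
  have 1: "br h (br h X) - sc 3 (br h X) + sc 2 X \<in> eigvecs h"
    by (rule eigvecsI[of _ _ 0]) (simp add: br_linear assms)
  have 2: "sc 4 (br h X) - sc 2 (br h (br h X)) \<in> eigvecs h"
    by (rule eigvecsI[of _ _ 1]) (simp add: br_linear assms sc_numeral_expand algebra_simps)
  have 3: "br h (br h X) - br h X \<in> eigvecs h"
    by (rule eigvecsI[of _ _ 2]) (simp add: br_linear assms sc_numeral_expand algebra_simps)
  have 4: "X + X = (br h (br h X) - sc 3 (br h X) + sc 2 X)
      + (sc 4 (br h X) - sc 2 (br h (br h X))) + (br h (br h X) - br h X)"
    by (simp add: sc_numeral_expand algebra_simps)
  show ?thesis
    by (rule span_double, subst 4) (intro span_add span_base 1 2 3)
qed

text \<open>The same interpolation at the points 0, 1, -1.\<close>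

lemma span_eigvecs_cubic_101:
  assumes "br h (br h (br h X)) = br h X"
  shows "X \<in> span (eigvecs h)"
proof -
  have 1: "sc 2 X - sc 2 (br h (br h X)) \<in> eigvecs h"
    by (rule eigvecsI[of _ _ 0]) (simp add: br_linear assms)
  have 2: "br h (br h X) + br h X \<in> eigvecs h"
    by (rule eigvecsI[of _ _ 1]) (simp add: br_linear assms)
  have 3: "br h (br h X) - br h X \<in> eigvecs h"
    by (rule eigvecsI[of _ _ "- 1"]) (simp add: br_linear assms)
  have 4: "X + X = (sc 2 X - sc 2 (br h (br h X))) + (br h (br h X) + br h X)
      + (br h (br h X) - br h X)"
    by (simp add: sc_numeral_expand algebra_simps)
  show ?thesis
    by (rule span_double, subst 4) (intro span_add span_base 1 2 3)
qed

lemma eigvecs_minus: "eigvecs (- h) = eigvecs h"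
proof -
  have "eigvecs (- k) \<subseteq> eigvecs k" for k
  proof
    fix X assume "X \<in> eigvecs (- k)"
    then obtain c where c: "br (- k) X = sc c X" unfolding eigvecs_def by blast
    have "br k X = - br (- k) X" by (simp only: br_minus_left minus_minus)
    also have "\<dots> = sc (- c) X" by (simp only: c scale_minus_left)
    finally show "X \<in> eigvecs k" by (rule eigvecsI)
  qed
  from this[of h] this[of "- h"] show ?thesis by (simp only: minus_minus subset_antisym)
qed

end

section \<open>The Hermitian decomposition\<close>

text \<open>Full antisymmetry comes from the compact form: an element killed by all double brackets
  has zero Killing square, so it vanishes if it is fixed by \<theta>. Arbitrary elements reduce to
  fixed ones.\<close>

lemma hermitian_setup_lie_algebra:
  assumes "hermitian_setup sc br \<sigma> \<theta> \<Upsilon>"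
  shows "lie_algebra sc br"
proof -
  have L: "fin_dim_lie_algebra sc br" and \<theta>: "antilinear_involution sc br \<theta>"
    and compact: "compact_real_form sc br \<theta>"
    using assms unfolding hermitian_setup_def simple_lie_algebra_def by - (elim conjE, assumption)+
  interpret vector_space sc using L unfolding fin_dim_lie_algebra_def by blast
  interpret left_lie_algebra sc br
    using L unfolding fin_dim_lie_algebra_def by unfold_locales blast+
  have \<theta>_add: "\<theta> (x + y) = \<theta> x + \<theta> y" and \<theta>_sc: "\<theta> (sc c x) = sc (cnj c) (\<theta> x)"
    and \<theta>_br: "\<theta> (br x y) = br (\<theta> x) (\<theta> y)" and \<theta>_\<theta>: "\<theta> (\<theta> x) = x" for x y c
    using \<theta> unfolding antilinear_involution_def by blast+
  have \<theta>_0: "\<theta> 0 = 0" using \<theta>_add[of 0 0] by simp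
  have fixed_0: "X = 0" if "\<theta> X = X" and X: "\<And>z y. br z (br X y) = 0" for X
  proof (rule ccontr)
    assume "X \<noteq> 0"
    then have "Re (killing sc br X X) < 0"
      using compact that(1) unfolding compact_real_form_def by blast
    moreover have "killing sc br X X = 0"
      unfolding killing_def lie_trace_def by (simp add: X representation_zero)
    ultimately show False by simp
  qed
  have faithful: "n = 0" if n: "\<And>z y. br z (br n y) = 0" for n
  proof -
    have \<theta>n: "br z (br (\<theta> n) y) = 0" for z y
    proof -
      have "br z (br (\<theta> n) y) = \<theta> (br (\<theta> z) (br n (\<theta> y)))" by (simp add: \<theta>_br \<theta>_\<theta>)
      then show ?thesis by (simp add: n \<theta>_0)
    qed
    have "n + \<theta> n = 0"
      by (rule fixed_0) (simp_all add: \<theta>_add \<theta>_\<theta> add.commute br_br_add_middle n \<theta>n)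
    \<comment> \<open>As \<theta> is antilinear, \<open>sc \<i> n\<close> is now a fixed
      vector.\<close>
    then have "\<theta> n = - n" by (simp add: add_eq_0_iff)
    with fixed_0[of "sc \<i> n"] have "sc \<i> n = 0"
      by (simp add: \<theta>_sc br_br_scale_middle n)
    then show ?thesis by simp
  qed
  show ?thesis
  proof unfold_locales
    show "br x y = - br y x" for x y using faithful by (rule br_antisym)
    show "\<exists>B. finite B \<and> span B = UNIV"
      using L unfolding fin_dim_lie_algebra_def by blast
  qed
qed

locale hermitian =
  fixes sc :: "complex \<Rightarrow> 'g::ab_group_add \<Rightarrow> 'g" 
    and br :: "'g \<Rightarrow> 'g \<Rightarrow> 'g" and \<sigma> \<theta> :: "'g \<Rightarrow> 'g" and \<Upsilon> :: 'g
  assumes hermitian: "hermitian_setup sc br \<sigma> \<theta> \<Upsilon>"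

sublocale hermitian \<subseteq> lie_algebra sc br
  using hermitian by (rule hermitian_setup_lie_algebra)

context hermitian
begin

abbreviation "\<kk> \<equiv> kk \<sigma> \<theta>"
abbreviation "\<mm> \<equiv> mm \<sigma> \<theta>"
abbreviation "\<mm>p \<equiv> mplus sc br \<sigma> \<theta> \<Upsilon>"
abbreviation "\<mm>m \<equiv> mminus sc br \<sigma> \<theta> \<Upsilon>"

lemma \<sigma>_add: "\<sigma> (x + y) = \<sigma> x + \<sigma> y" and \<sigma>_sc: "\<sigma> (sc c x) = sc (cnj c) (\<sigma> x)"
  and \<sigma>_br: "\<sigma> (br x y) = br (\<sigma> x) (\<sigma> y)" and \<sigma>_\<sigma> [simp]: "\<sigma> (\<sigma> x) = x"
  and \<theta>_add: "\<theta> (x + y) = \<theta> x + \<theta> y" and \<theta>_sc: "\<theta> (sc c x) = sc (cnj c) (\<theta> x)"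
  and \<theta>_br: "\<theta> (br x y) = br (\<theta> x) (\<theta> y)" and \<theta>_\<theta> [simp]: "\<theta> (\<theta> x) = x"
  and \<sigma>_\<theta>: "\<sigma> (\<theta> x) = \<theta> (\<sigma> x)"
  using hermitian unfolding hermitian_setup_def antilinear_involution_def by - (elim conjE, (erule allE)+, assumption)+

lemma \<sigma>_minus: "\<sigma> (- x) = - \<sigma> x" and \<theta>_minus: "\<theta> (- x) = - \<theta> x"
  using \<sigma>_sc[of "- 1" x] \<theta>_sc[of "- 1" x] by simp_all

lemma \<sigma>_diff: "\<sigma> (x - y) = \<sigma> x - \<sigma> y" and \<theta>_diff: "\<theta> (x - y) = \<theta> x - \<theta> y"
  using \<sigma>_add[of x "- y"] \<theta>_add[of x "- y"] by (simp_all add: \<sigma>_minus \<theta>_minus)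

lemma \<sigma>_0 [simp]: "\<sigma> 0 = 0" and \<theta>_0 [simp]: "\<theta> 0 = 0"
  using \<sigma>_add[of 0 0] \<theta>_add[of 0 0] by simp_all

lemma \<sigma>_sum: "\<sigma> (\<Sum>i\<in>I. f i) = (\<Sum>i\<in>I. \<sigma> (f i))"
  by (induction I rule: infinite_finite_induct) (simp_all add: \<sigma>_add)

lemmas \<sigma>_simps = \<sigma>_add \<sigma>_diff \<sigma>_minus \<sigma>_sc \<sigma>_br

lemma \<sigma>_\<Upsilon>: "\<sigma> \<Upsilon> = \<Upsilon>" and \<Upsilon>_kk: "\<Upsilon> \<in> \<kk>"
  and \<Upsilon>_\<Upsilon>: "A \<in> \<mm> \<Longrightarrow> br \<Upsilon> (br \<Upsilon> A) = - A"
  using hermitian unfolding hermitian_setup_def by - (elim conjE, assumption | elim conjE, erule (1) bspec)+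

lemma subspace_kk: "subspace \<kk>" and subspace_mm: "subspace \<mm>"
  unfolding subspace_def kk_def mm_def by (auto simp: \<sigma>_add \<sigma>_sc \<theta>_add \<theta>_sc)

lemma subspace_mp: "subspace \<mm>p" and subspace_mn: "subspace \<mm>m"
  using subspace_mm unfolding subspace_def mplus_def mminus_def
  by (auto simp: br_linear scale_right_distrib scale_left_commute)

lemma br_kk_mm: "X \<in> \<kk> \<Longrightarrow> Y \<in> \<mm> \<Longrightarrow> br X Y \<in> \<mm>"
  and br_mm_mm: "X \<in> \<mm> \<Longrightarrow> Y \<in> \<mm> \<Longrightarrow> br X Y \<in> \<kk>"
  unfolding kk_def mm_def by (simp_all add: \<sigma>_br \<theta>_br br_linear)

lemma \<sigma>_kk: "X \<in> \<kk> \<Longrightarrow> \<sigma> X \<in> \<kk>" and \<sigma>_mm: "X \<in> \<mm> \<Longrightarrow> \<sigma> X \<in> \<mm>"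
  unfolding kk_def mm_def by (simp_all flip: \<sigma>_\<theta> add: \<sigma>_minus)

text \<open>The setup gives commutation only with \<sigma>-fixed elements of \<open>\<kk>\<close>.
  Both \<open>X + \<sigma> X\<close> and \<open>sc \<i> (X - \<sigma> X)\<close> are such elements
  and together recover \<open>X\<close>.\<close>

lemma \<Upsilon>_central: "X \<in> \<kk> \<Longrightarrow> br \<Upsilon> X = 0"
proof -
  assume X: "X \<in> \<kk>"
  have real: "br \<Upsilon> Y = 0" if "Y \<in> \<kk>" "\<sigma> Y = Y" for Y
    using hermitian that unfolding hermitian_setup_def by blast
  have "br \<Upsilon> (X + \<sigma> X) = 0"
    using X by (intro real subspace_add subspace_kk \<sigma>_kk) (auto simp: \<sigma>_add add.commute)
  moreover have "br \<Upsilon> (sc \<i> (X - \<sigma> X)) = 0"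
    using X by (intro real subspace_scale subspace_diff subspace_kk \<sigma>_kk)
      (auto simp: \<sigma>_simps scale_right_diff_distrib)
  ultimately have "br \<Upsilon> X + br \<Upsilon> X = 0"
    by (simp add: br_linear)
  then show ?thesis by (rule double_eq_0)
qed

lemma kk_mm_decomposition:
  obtains Y Z where "Y \<in> \<kk>" "Z \<in> \<mm>" "X = Y + Z"
proof
  show "sc (1/2) (X + \<sigma> (\<theta> X)) \<in> \<kk>"
    unfolding kk_def by (simp add: \<sigma>_simps \<theta>_sc \<theta>_add add.commute flip: \<sigma>_\<theta>)
  show "sc (1/2) (X - \<sigma> (\<theta> X)) \<in> \<mm>"
    unfolding mm_def by (simp add: \<sigma>_simps \<theta>_sc \<theta>_diff scale_right_diff_distrib flip: \<sigma>_\<theta>)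
  show "X = sc (1/2) (X + \<sigma> (\<theta> X)) + sc (1/2) (X - \<sigma> (\<theta> X))"
    using half_double[of X] by (simp add: algebra_simps)
qed

text \<open>The components come from the spectral projections
  \<open>(1 - \<i> ad \<Upsilon>) / 2\<close> and \<open>(1 + \<i> ad \<Upsilon>) / 2\<close>, which
  \<sigma> interchanges.\<close>

lemma mm_decomposition:
  assumes "A \<in> \<mm>"
  obtains B C where "B \<in> \<mm>p" "C \<in> \<mm>m" "A = B + C" "\<sigma> A = A \<Longrightarrow> C = \<sigma> B"
proof
  have UA: "br \<Upsilon> A \<in> \<mm>" using \<Upsilon>_kk assms by (rule br_kk_mm)
  show "sc (1/2) (A - sc \<i> (br \<Upsilon> A)) \<in> \<mm>p"
    unfolding mplus_def using assms UA
    by (auto intro!: subspace_scale subspace_diff subspace_mm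
        simp: br_linear \<Upsilon>_\<Upsilon> scale_right_diff_distrib scale_right_distrib)
  show "sc (1/2) (A + sc \<i> (br \<Upsilon> A)) \<in> \<mm>m"
    unfolding mminus_def using assms UA
    by (auto intro!: subspace_scale subspace_add subspace_mm
        simp: br_linear \<Upsilon>_\<Upsilon> scale_right_diff_distrib scale_right_distrib)
  show "A = sc (1/2) (A - sc \<i> (br \<Upsilon> A)) + sc (1/2) (A + sc \<i> (br \<Upsilon> A))"
    using half_double[of A] by (simp add: algebra_simps)
  show "sc (1/2) (A + sc \<i> (br \<Upsilon> A)) = \<sigma> (sc (1/2) (A - sc \<i> (br \<Upsilon> A)))" if "\<sigma> A = A"
    using that by (simp add: \<sigma>_simps \<sigma>_\<Upsilon>)
qed

text \<open>Bracketing with \<Upsilon> kills the \<open>\<kk>\<close> part and maps into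
  \<open>\<mm>\<close>, so a nonzero multiple of \<open>Y\<close> lies in
  \<open>\<mm>\<close>.\<close>

lemma \<Upsilon>_eigenvector_mm:
  assumes "br \<Upsilon> Y = sc c Y" "c \<noteq> 0" shows "Y \<in> \<mm>"
proof -
  obtain K M where KM: "K \<in> \<kk>" "M \<in> \<mm>" "Y = K + M"
    by (rule kk_mm_decomposition)
  then have "br \<Upsilon> M \<in> \<mm>" "br \<Upsilon> Y = br \<Upsilon> M"
    using \<Upsilon>_kk by (auto simp: br_kk_mm br_add_right \<Upsilon>_central)
  then have "sc c Y \<in> \<mm>" using assms(1) by simp
  then have "sc (inverse c) (sc c Y) \<in> \<mm>" by (rule subspace_scale[OF subspace_mm])
  then show ?thesis using assms(2) by simp
qed

lemma mpI: "br \<Upsilon> Y = sc \<i> Y \<Longrightarrow> Y \<in> \<mm>p" and mnI: "br \<Upsilon> Y = sc (- \<i>) Y \<Longrightarrow> Y \<in> \<mm>m"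
  using \<Upsilon>_eigenvector_mm[of Y \<i>] \<Upsilon>_eigenvector_mm[of Y "- \<i>"]
  unfolding mplus_def mminus_def by simp_all

lemma mpD: "Y \<in> \<mm>p \<Longrightarrow> br \<Upsilon> Y = sc \<i> Y" "Y \<in> \<mm>p \<Longrightarrow> Y \<in> \<mm>"
  and mnD: "Y \<in> \<mm>m \<Longrightarrow> br \<Upsilon> Y = sc (- \<i>) Y" "Y \<in> \<mm>m \<Longrightarrow> Y \<in> \<mm>"
  unfolding mplus_def mminus_def by auto

lemma \<Upsilon>_eigenvalue:
  assumes "br \<Upsilon> Y = sc c Y" "Y \<noteq> 0" shows "c = 0 \<or> c = \<i> \<or> c = - \<i>"
proof (cases "c = 0")
  case False
  then have "br \<Upsilon> (br \<Upsilon> Y) = - Y" using assms by (intro \<Upsilon>_\<Upsilon> \<Upsilon>_eigenvector_mm)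
  then have "sc (c\<^sup>2 + 1) Y = 0"
    using assms(1) by (simp add: br_scale_right scale_left_distrib power2_eq_square)
  then have "c\<^sup>2 = \<i>\<^sup>2" using assms(2) by (simp add: eq_neg_iff_add_eq_0)
  then show ?thesis unfolding power2_eq_iff by simp
qed simp

lemma mp_mn_disjoint: "Y \<in> \<mm>p \<Longrightarrow> Y \<in> \<mm>m \<Longrightarrow> Y = 0"
  using mpD(1)[of Y] mnD(1)[of Y] by (simp only: scale_cancel_right) simp

text \<open>The bracket would have \<Upsilon>-eigenvalue \<open>2 \<i>\<close>, but it lies in
  \<open>\<kk>\<close>, where \<Upsilon> acts by zero.\<close>

lemma br_mp_mp: "X \<in> \<mm>p \<Longrightarrow> Y \<in> \<mm>p \<Longrightarrow> br X Y = 0"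
proof -
  assume XY: "X \<in> \<mm>p" "Y \<in> \<mm>p"
  have "br \<Upsilon> (br X Y) = br (br \<Upsilon> X) Y + br X (br \<Upsilon> Y)" by (simp add: br_br_left)
  also have "\<dots> = sc (\<i> + \<i>) (br X Y)"
    unfolding scale_left_distrib using XY by (simp only: mpD br_linear)
  finally have "sc (\<i> + \<i>) (br X Y) = 0"
    using XY by (simp add: \<Upsilon>_central br_mm_mm mpD)
  then show ?thesis by simp
qed

lemma \<sigma>_mp: "X \<in> \<mm>p \<Longrightarrow> \<sigma> X \<in> \<mm>m" and \<sigma>_mn: "X \<in> \<mm>m \<Longrightarrow> \<sigma> X \<in> \<mm>p"
proof -
  have *: "br \<Upsilon> (\<sigma> X) = \<sigma> (br \<Upsilon> X)" for X by (simp add: \<sigma>_br \<sigma>_\<Upsilon>)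
  show "X \<in> \<mm>p \<Longrightarrow> \<sigma> X \<in> \<mm>m" by (intro mnI) (simp only: * mpD \<sigma>_sc complex_cnj_i)
  show "X \<in> \<mm>m \<Longrightarrow> \<sigma> X \<in> \<mm>p"
    by (intro mpI) (simp only: * mnD \<sigma>_sc complex_cnj_i complex_cnj_minus minus_minus)
qed

lemma br_mn_mn: "X \<in> \<mm>m \<Longrightarrow> Y \<in> \<mm>m \<Longrightarrow> br X Y = 0"
  using br_mp_mp[of "\<sigma> X" "\<sigma> Y"] \<sigma>_mn \<sigma>_br by (metis \<sigma>_0 \<sigma>_\<sigma>)

lemma br_mp_mn: "X \<in> \<mm>p \<Longrightarrow> Y \<in> \<mm>m \<Longrightarrow> br X Y \<in> \<kk>"
  and br_mn_mp: "Y \<in> \<mm>m \<Longrightarrow> X \<in> \<mm>p \<Longrightarrow> br Y X \<in> \<kk>"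
  by (simp_all add: br_mm_mm mpD mnD)

lemma br_kk_mp: "X \<in> \<kk> \<Longrightarrow> Y \<in> \<mm>p \<Longrightarrow> br X Y \<in> \<mm>p"
  and br_kk_mn: "X \<in> \<kk> \<Longrightarrow> Y \<in> \<mm>m \<Longrightarrow> br X Y \<in> \<mm>m"
  using br_commute_if[OF \<Upsilon>_central, of X Y]
  by (auto intro!: mpI mnI simp: mpD mnD br_linear)

lemma br_mp_kk: "Y \<in> \<mm>p \<Longrightarrow> X \<in> \<kk> \<Longrightarrow> br Y X \<in> \<mm>p"
  and br_mn_kk: "Y \<in> \<mm>m \<Longrightarrow> X \<in> \<kk> \<Longrightarrow> br Y X \<in> \<mm>m"
  using br_kk_mp[of X Y] br_kk_mn[of X Y] br_anti[of Y X]
  by (simp_all add: subspace_neg subspace_mp subspace_mn)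

lemma span_eqI_graded:
  assumes "\<kk> \<subseteq> span S" "\<mm>p \<subseteq> span S" "\<mm>m \<subseteq> span S"
  shows "span S = UNIV"
proof -
  have "X \<in> span S" for X
  proof -
    obtain K M where "K \<in> \<kk>" "M \<in> \<mm>" "X = K + M" by (rule kk_mm_decomposition)
    moreover from \<open>M \<in> \<mm>\<close> obtain B C where "B \<in> \<mm>p" "C \<in> \<mm>m" "M = B + C"
      by (rule mm_decomposition)
    ultimately show ?thesis using assms by (auto intro!: span_add)
  qed
  then show ?thesis by blast
qed

lemma span_eigvecs_\<Upsilon>: "span (eigvecs \<Upsilon>) = UNIV"
proof (rule span_eqI_graded)
  show "\<kk> \<subseteq> span (eigvecs \<Upsilon>)"
    by (auto intro!: span_base eigvecsI[of _ _ 0] simp: \<Upsilon>_central)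
  show "\<mm>p \<subseteq> span (eigvecs \<Upsilon>)" "\<mm>m \<subseteq> span (eigvecs \<Upsilon>)"
    by (auto intro!: span_base eigvecsI dest: mpD mnD)
qed

lemma \<Upsilon>_centralizer: "br \<Upsilon> X = 0 \<Longrightarrow> X \<in> \<kk>"
proof -
  assume X: "br \<Upsilon> X = 0"
  obtain K M where KM: "K \<in> \<kk>" "M \<in> \<mm>" "X = K + M" by (rule kk_mm_decomposition)
  then have "br \<Upsilon> M = 0" using X by (simp add: br_add_right \<Upsilon>_central)
  then have "M = 0" using \<Upsilon>_\<Upsilon>[OF KM(2)] by simp
  then show ?thesis using KM by simp
qed

text \<open>The difference \<open>X - Y\<close> lies in \<open>\<mm>p\<close> and, by the equation,
  also in \<open>\<mm>m\<close>. This is the uniqueness of the holomorphic part of a real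
  vector.\<close>

lemma add_\<sigma>_inject:
  assumes "X \<in> \<mm>p" "Y \<in> \<mm>p" "X + \<sigma> X = Y + \<sigma> Y" shows "X = Y"
proof -
  have "X - Y = \<sigma> (Y - X)" using assms(3) by (simp add: \<sigma>_diff algebra_simps)
  moreover have "X - Y \<in> \<mm>p" "\<sigma> (Y - X) \<in> \<mm>m"
    using assms by (auto intro: subspace_diff subspace_mp \<sigma>_mp)
  ultimately have "X - Y = 0" by (metis mp_mn_disjoint)
  then show ?thesis by simp
qed

end

section \<open>Strongly orthogonal triples and the Cartan subalgebra\<close>

locale orthogonal_triples = hermitian sc br \<sigma> \<theta> \<Upsilon>
  for sc :: "complex \<Rightarrow> 'g::ab_group_add \<Rightarrow> 'g" and br \<sigma> \<theta> \<Upsilon> +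
  fixes t :: "'g set" and \<Psi> :: "('g \<Rightarrow> complex) set" and e :: "('g \<Rightarrow> complex) \<Rightarrow> 'g"
  assumes cartan: "cartan_subalgebra sc br t"
    and t_in_k: "t \<subseteq> kk \<sigma> \<theta>"
    and t_theta: "\<forall>h\<in>t. \<theta> h \<in> t"
    and Psi: "max_strongly_orthogonal_set sc br t (mplus sc br \<sigma> \<theta> \<Upsilon>) \<Psi>"
    and e_root: "\<forall>\<psi>\<in>\<Psi>. e \<psi> \<in> root_space sc br t \<psi> \<and> e \<psi> \<noteq> 0"
    and sl2_e: "\<forall>\<psi>\<in>\<Psi>. br (br (e \<psi>) (\<sigma> (e \<psi>))) (e \<psi>) = sc 2 (e \<psi>)"
    and sl2_f: "\<forall>\<psi>\<in>\<Psi>. br (br (e \<psi>) (\<sigma> (e \<psi>))) (\<sigma> (e \<psi>)) = sc (- 2) (\<sigma> (e \<psi>))"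
begin

abbreviation f where "f \<psi> \<equiv> \<sigma> (e \<psi>)"
abbreviation h where "h \<psi> \<equiv> br (e \<psi>) (f \<psi>)"

lemma toral_t: "toral sc br t"
  using cartan unfolding cartan_subalgebra_def by blast

lemma subspace_t: "subspace t" and br_t_t: "x \<in> t \<Longrightarrow> y \<in> t \<Longrightarrow> br x y = 0"
  using toral_t unfolding toral_def by blast+

text \<open>With \<Upsilon> in \<open>t\<close>, the value of a weight at \<Upsilon> tells in which
  of \<open>\<kk>\<close>, \<open>\<mm>p\<close>, \<open>\<mm>m\<close> its weight vectors
  lie.\<close>

lemma \<Upsilon>_t: "\<Upsilon> \<in> t"
proof (rule diagonalizable_commuting_in_cartan[OF cartan _ span_eigvecs_\<Upsilon>])
  show "br k \<Upsilon> = 0" if "k \<in> t" for k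
    using that t_in_k br_anti[of k \<Upsilon>] \<Upsilon>_central[of k] by auto
qed

lemma e_mp: "\<psi> \<in> \<Psi> \<Longrightarrow> e \<psi> \<in> \<mm>p" and f_mn: "\<psi> \<in> \<Psi> \<Longrightarrow> f \<psi> \<in> \<mm>m"
proof -
  show "\<psi> \<in> \<Psi> \<Longrightarrow> e \<psi> \<in> \<mm>p"
    using e_root Psi unfolding max_strongly_orthogonal_set_def by blast
  then show "\<psi> \<in> \<Psi> \<Longrightarrow> f \<psi> \<in> \<mm>m" by (rule \<sigma>_mp)
qed

lemma e_nonzero: "\<psi> \<in> \<Psi> \<Longrightarrow> e \<psi> \<noteq> 0"
  and br_t_e: "\<psi> \<in> \<Psi> \<Longrightarrow> k \<in> t \<Longrightarrow> br k (e \<psi>) = sc (\<psi> k) (e \<psi>)"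
  using e_root unfolding root_space_def by auto

lemma h_kk: "\<psi> \<in> \<Psi> \<Longrightarrow> h \<psi> \<in> \<kk>"
  by (intro br_mp_mn e_mp f_mn)

lemma \<sigma>_t: "k \<in> t \<Longrightarrow> \<sigma> k \<in> t"
proof -
  assume k: "k \<in> t"
  then have "\<sigma> (\<theta> k) = k" using t_in_k unfolding kk_def by blast
  then have "\<theta> k = \<sigma> k" using \<sigma>_\<sigma>[of "\<theta> k"] by simp
  then show ?thesis using t_theta k by metis
qed

text \<open>That \<open>f \<psi>\<close> has weight \<open>- \<psi>\<close> is forced by the relation \<open>[h, e] = 2 e\<close>: the weight of
  \<open>h \<psi>\<close> shifts the weight of \<open>e \<psi>\<close> to itself, so it is zero.\<close>
lemma br_t_f_h:
  assumes "\<psi> \<in> \<Psi>" "k \<in> t"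
  shows "br k (f \<psi>) = sc (- \<psi> k) (f \<psi>)" "br k (h \<psi>) = 0"
proof -
  define c where "c = cnj (\<psi> (\<sigma> k))"
  have "br k (f \<psi>) = \<sigma> (br (\<sigma> k) (e \<psi>))" by (simp add: \<sigma>_br)
  then have f: "br k (f \<psi>) = sc c (f \<psi>)"
    using assms by (simp add: br_t_e \<sigma>_t \<sigma>_sc c_def)
  have "br k (h \<psi>) = br (br k (e \<psi>)) (f \<psi>) + br (e \<psi>) (br k (f \<psi>))"
    by (simp add: br_br_left)
  then have hk: "br k (h \<psi>) = sc (\<psi> k + c) (h \<psi>)"
    using assms by (simp add: f br_t_e br_linear scale_left_distrib)
  have "br k (br (h \<psi>) (e \<psi>)) = br (br k (h \<psi>)) (e \<psi>) + br (h \<psi>) (br k (e \<psi>))"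
    by (simp add: br_br_left[of k "h \<psi>" "e \<psi>"])
  then have "sc ((\<psi> k + c) * 2) (e \<psi>) = 0"
    using assms sl2_e by (simp add: hk br_t_e br_linear mult.commute)
  then have "\<psi> k + c = 0" using e_nonzero[OF assms(1)] unfolding scale_eq_0_iff mult_eq_0_iff by simp
  then show "br k (f \<psi>) = sc (- \<psi> k) (f \<psi>)" "br k (h \<psi>) = 0"
    using f hk by (simp_all add: add_eq_0_iff)
qed

lemma sl2_triple: "\<psi> \<in> \<Psi> \<Longrightarrow> sl2_triple sc br (e \<psi>) (h \<psi>) (f \<psi>)"
  using sl2_e sl2_f by unfold_locales auto

lemma sl2_triple_swap: "\<psi> \<in> \<Psi> \<Longrightarrow> sl2_triple sc br (f \<psi>) (- h \<psi>) (e \<psi>)"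
  using sl2_e sl2_f br_anti[of "f \<psi>" "e \<psi>"] by unfold_locales (auto simp: br_minus_left)

text \<open>One bracket with \<open>e \<psi>\<close> or \<open>f \<psi>\<close> takes
  \<open>\<kk>\<close> into \<open>\<mm>p\<close> or \<open>\<mm>m\<close>, and a second one gives
  zero because these are abelian.\<close>

lemma h_kk_cubic:
  assumes "\<psi> \<in> \<Psi>" "X \<in> \<kk>" shows "br (h \<psi>) (br (h \<psi>) (br (h \<psi>) X)) = br (h \<psi>) X"
  using assms by (intro sl2_triple.short_weight_cubic[OF sl2_triple] br_mp_mp br_mn_mn
      br_mp_kk br_mn_kk e_mp f_mn)

text \<open>The cubic identities give eigenvalues among 0, 1, -1 on \<open>\<kk>\<close> and 0, 1, 2
  on \<open>\<mm>p\<close>. On \<open>\<mm>m\<close> the triple with \<open>e\<close> and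
  \<open>f\<close> exchanged is used, whose middle element is \<open>- h \<psi>\<close>.\<close>

lemma span_eigvecs_h:
  assumes \<psi>: "\<psi> \<in> \<Psi>" shows "span (eigvecs (h \<psi>)) = UNIV"
proof (rule span_eqI_graded)
  show "\<kk> \<subseteq> span (eigvecs (h \<psi>))"
    using \<psi> by (auto intro: span_eigvecs_cubic_101 h_kk_cubic)
  show "\<mm>p \<subseteq> span (eigvecs (h \<psi>))"
  proof
    fix A assume "A \<in> \<mm>p"
    with \<psi> show "A \<in> span (eigvecs (h \<psi>))"
      by (intro span_eigvecs_cubic_012 sl2_triple.highest_weight_cubic[OF sl2_triple]
          br_mp_mp br_mn_mn br_mn_kk br_mn_mp e_mp f_mn)
  qed
  show "\<mm>m \<subseteq> span (eigvecs (h \<psi>))"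
  proof
    fix A assume "A \<in> \<mm>m"
    with \<psi> have "A \<in> span (eigvecs (- h \<psi>))"
      by (intro span_eigvecs_cubic_012 sl2_triple.highest_weight_cubic[OF sl2_triple_swap]
          br_mp_mp br_mn_mn br_mp_kk br_mp_mn e_mp f_mn)
    then show "A \<in> span (eigvecs (h \<psi>))" by (simp add: eigvecs_minus)
  qed
qed

lemma h_t: "\<psi> \<in> \<Psi> \<Longrightarrow> h \<psi> \<in> t"
  by (rule diagonalizable_commuting_in_cartan[OF cartan]) (simp_all add: br_t_f_h span_eigvecs_h)

lemma root_h: "\<psi> \<in> \<Psi> \<Longrightarrow> \<psi> (h \<psi>) = 2"
  using br_t_e[OF _ h_t, of \<psi> \<psi>] sl2_e e_nonzero by auto

lemma root_\<Upsilon>: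
  assumes "Y \<in> \<mm>p" "Y \<noteq> 0" "Y \<in> root_space sc br t \<beta>" shows "\<beta> \<Upsilon> = \<i>"
  using assms mpD(1)[of Y] \<Upsilon>_t unfolding root_space_def by auto

lemma strongly_orthogonal_\<Psi>:
  "\<psi> \<in> \<Psi> \<Longrightarrow> \<psi>' \<in> \<Psi> \<Longrightarrow> \<psi> \<noteq> \<psi>' \<Longrightarrow> strongly_orthogonal sc br t \<psi> \<psi>'"
  using Psi unfolding max_strongly_orthogonal_set_def by blast

text \<open>The bracket has weight \<open>\<psi> - \<psi>'\<close>, which is nonzero on
  \<open>t\<close> and not a root.\<close>

lemma br_e_f_orth:
  assumes "\<psi> \<in> \<Psi>" "\<psi>' \<in> \<Psi>" "\<psi> \<noteq> \<psi>'" shows "br (e \<psi>) (f \<psi>') = 0"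
proof -
  have so: "strongly_orthogonal sc br t \<psi> \<psi>'" using assms by (rule strongly_orthogonal_\<Psi>)
  then obtain k where "k \<in> t" "\<psi> k - \<psi>' k \<noteq> 0" unfolding strongly_orthogonal_def by auto
  then have "root_space sc br t (\<lambda>k. \<psi> k - \<psi>' k) = {0}"
    using so unfolding strongly_orthogonal_def is_root_def by blast
  moreover have "br k (br (e \<psi>) (f \<psi>')) = sc (\<psi> k - \<psi>' k) (br (e \<psi>) (f \<psi>'))" if "k \<in> t" for k
    using br_br_left[of k "e \<psi>" "f \<psi>'"] assms that
    by (simp add: br_t_e br_t_f_h br_linear scale_left_diff_distrib algebra_simps)
  ultimately show ?thesis unfolding root_space_def by auto
qed

lemma br_h_e:
  assumes "\<psi> \<in> \<Psi>" "\<psi>' \<in> \<Psi>"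
  shows "br (h \<psi>) (e \<psi>') = (if \<psi> = \<psi>' then sc 2 (e \<psi>') else 0)"
proof (cases "\<psi> = \<psi>'")
  case False
  then show ?thesis
    using assms br_e_f_orth[of \<psi>' \<psi>] br_anti[of "f \<psi>" "e \<psi>'"]
    by (simp add: br_br_left[of "e \<psi>" "f \<psi>"] br_mp_mp e_mp)
qed (use assms sl2_e in simp)

lemma \<sigma>_h: "\<sigma> (h \<psi>) = - h \<psi>"
  using br_anti[of "f \<psi>" "e \<psi>"] by (simp add: \<sigma>_br)

lemma br_h_f: "\<psi> \<in> \<Psi> \<Longrightarrow> \<psi>' \<in> \<Psi> \<Longrightarrow> br (h \<psi>) (f \<psi>') = (if \<psi> = \<psi>' then sc (- 2) (f \<psi>') else 0)"
  using arg_cong[OF br_h_e[of \<psi> \<psi>'], of \<sigma>] sl2_f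
  by (auto simp: \<sigma>_br[of "h \<psi>"] \<sigma>_h br_minus_left)

text \<open>The vectors \<open>e \<psi>\<close> have pairwise distinct weights and are therefore
  independent. Over an infinite set the sums below would collapse to the default value 0.\<close>

lemma finite_\<Psi>: "finite \<Psi>"
proof -
  have inj: "inj_on e \<Psi>"
  proof (rule inj_onI, rule ccontr)
    fix \<psi> \<psi>' assume "\<psi> \<in> \<Psi>" "\<psi>' \<in> \<Psi>" "e \<psi> = e \<psi>'" "\<psi> \<noteq> \<psi>'"
    then have "sc 2 (e \<psi>) = 0" using br_h_e[of \<psi> \<psi>] br_h_e[of \<psi> \<psi>'] by simp
    then show False using e_nonzero \<open>\<psi> \<in> \<Psi>\<close> by simp
  qed
  have "u (e \<psi>) = 0"
    if I: "finite I" "I \<subseteq> \<Psi>" and sum: "(\<Sum>\<psi>\<in>I. sc (u (e \<psi>)) (e \<psi>)) = 0" and "\<psi> \<in> I" for u I \<psi>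
  proof -
    have "\<forall>\<psi>\<in>I. sc (u (e \<psi>)) (e \<psi>) \<in> {0}"
    proof (rule weight_components_in_subspace[where H = t and c = "\<lambda>\<psi>. \<psi>"])
      show "br k (sc (u (e \<psi>)) (e \<psi>)) = sc (\<psi> k) (sc (u (e \<psi>)) (e \<psi>))"
        if "\<psi> \<in> I" "k \<in> t" for \<psi> k
        using that I by (auto simp: br_scale_right br_t_e subset_iff scale_left_commute)
      show "\<exists>k\<in>t. \<psi> k \<noteq> \<psi>' k" if "\<psi> \<in> I" "\<psi>' \<in> I" "\<psi> \<noteq> \<psi>'" for \<psi> \<psi>'
        using strongly_orthogonal_\<Psi>[of \<psi> \<psi>'] that I unfolding strongly_orthogonal_def by blast
    qed (use I sum in \<open>auto simp: subspace_def\<close>)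
    then show ?thesis using \<open>\<psi> \<in> I\<close> I(2) e_nonzero[of \<psi>] by auto
  qed
  note coeff = this
  have "independent (e ` \<Psi>)"
    unfolding independent_explicit_module
  proof (intro allI impI)
    fix T u x assume T: "finite T" "T \<subseteq> e ` \<Psi>" "(\<Sum>v\<in>T. sc (u v) v) = 0" "x \<in> T"
    obtain I where I: "I \<subseteq> \<Psi>" "finite I" "T = e ` I"
      using finite_subset_image[OF T(1,2)] by blast
    have "(\<Sum>\<psi>\<in>I. sc (u (e \<psi>)) (e \<psi>)) = 0"
      using T(3) inj_on_subset[OF inj I(1)] by (simp add: I(3) sum.reindex)
    then show "u x = 0"
      using coeff[OF I(2,1)] T(4) I(3) by blast
  qed
  then have "finite (e ` \<Psi>)"
    using finite_dim independent_span_bound by (metis subset_UNIV)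
  then show ?thesis using inj by (rule finite_imageD)
qed

end

section \<open>Weights on the holomorphic part\<close>

context orthogonal_triples
begin

text \<open>This is where the maximality of \<Psi> enters. If \<beta> vanished on all coroots, it
  would be strongly orthogonal to every \<psi>: \<open>\<beta> + \<psi>\<close> has the impossible
  value \<open>2 \<i>\<close> at \<Upsilon>, and \<open>\<beta> - \<psi>\<close> would give
  \<open>h \<psi>\<close> the eigenvalue -2 on \<open>\<kk>\<close>, against the cubic
  identity.\<close>

lemma weight_nonzero:
  assumes Y: "Y \<in> \<mm>p" "Y \<noteq> 0" "Y \<in> root_space sc br t \<beta>"
  shows "is_root sc br t \<beta>" "\<exists>\<psi>\<in>\<Psi>. \<beta> (h \<psi>) \<noteq> 0"
proof -
  have \<beta>\<Upsilon>: "\<beta> \<Upsilon> = \<i>" using Y by (rule root_\<Upsilon>)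
  then show root: "is_root sc br t \<beta>"
    using Y \<Upsilon>_t unfolding is_root_def by (auto intro!: bexI[of _ \<Upsilon>])
  show "\<exists>\<psi>\<in>\<Psi>. \<beta> (h \<psi>) \<noteq> 0"
  proof (rule ccontr)
    assume "\<not> (\<exists>\<psi>\<in>\<Psi>. \<beta> (h \<psi>) \<noteq> 0)"
    then have zero: "\<beta> (h \<psi>) = 0" if "\<psi> \<in> \<Psi>" for \<psi> using that by blast
    then have "\<beta> \<notin> \<Psi>" using root_h[of \<beta>] by auto
    moreover have "root_space sc br t \<beta> \<subseteq> \<mm>p"
      using \<Upsilon>_t \<beta>\<Upsilon> by (auto simp: root_space_def intro: mpI)
    moreover have "strongly_orthogonal sc br t \<beta> \<psi>" if \<psi>: "\<psi> \<in> \<Psi>" for \<psi>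
    proof -
      have \<psi>\<Upsilon>: "\<psi> \<Upsilon> = \<i>"
        using e_mp[OF \<psi>] e_nonzero[OF \<psi>] e_root \<psi> by (intro root_\<Upsilon>) auto
      have ne: "\<beta> (h \<psi>) \<noteq> \<psi> (h \<psi>)" "\<beta> (h \<psi>) \<noteq> - \<psi> (h \<psi>)"
        using \<psi> by (simp_all add: zero root_h)
      have sum: "X = 0" if "X \<in> root_space sc br t (\<lambda>k. \<beta> k + \<psi> k)" for X
      proof (rule ccontr)
        assume "X \<noteq> 0"
        moreover have "br \<Upsilon> X = sc (\<i> + \<i>) X"
          using that \<Upsilon>_t \<beta>\<Upsilon> \<psi>\<Upsilon> unfolding root_space_def by simp
        ultimately show False
          using \<Upsilon>_eigenvalue[of X "\<i> + \<i>"] by (simp add: complex_eq_iff)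
      qed
      have diff: "X = 0" if X: "X \<in> root_space sc br t (\<lambda>k. \<beta> k - \<psi> k)" for X
      proof -
        have "br \<Upsilon> X = 0"
          using X \<Upsilon>_t \<beta>\<Upsilon> \<psi>\<Upsilon> unfolding root_space_def by simp
        then have "br (h \<psi>) (br (h \<psi>) (br (h \<psi>) X)) = br (h \<psi>) X"
          by (intro h_kk_cubic \<psi> \<Upsilon>_centralizer)
        moreover have "br (h \<psi>) X = sc (- 2) X"
          using X h_t[OF \<psi>] \<psi> unfolding root_space_def by (simp add: zero root_h)
        ultimately have "sc (- 8) X = sc (- 2) X" by (simp add: br_linear)
        then show ?thesis by (simp only: scale_cancel_right) simp
      qed
      have not_root: "\<not> is_root sc br t \<gamma>" if "\<And>X. X \<in> root_space sc br t \<gamma> \<Longrightarrow> X = 0" for \<gamma>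
      proof -
        have "0 \<in> root_space sc br t \<gamma>" by (simp add: root_space_def)
        then have "root_space sc br t \<gamma> = {0}" using that by blast
        then show ?thesis by (simp add: is_root_def)
      qed
      show ?thesis
        unfolding strongly_orthogonal_def
        using h_t[OF \<psi>] ne not_root[OF sum] not_root[OF diff] by (intro conjI bexI[of _ "h \<psi>"])
    qed
    ultimately show False
      using Psi root unfolding max_strongly_orthogonal_set_def by blast
  qed
qed

text \<open>Apply \<open>e\<^sub>k f\<^sub>k\<close> to \<open>W = f\<^sub>i f\<^sub>j Y\<close>: this is zero because \<open>f\<^sub>k W = 0\<close>, while the commutation
  relations evaluate \<open>f\<^sub>k e\<^sub>k W + h\<^sub>k W\<close> to a multiple of \<open>W\<close>.\<close>
lemma ff_weight:
  assumes Y: "Y \<in> \<mm>p" and n: "\<And>\<psi>. \<psi> \<in> \<Psi> \<Longrightarrow> br (h \<psi>) Y = sc (n \<psi>) Y"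
    and i: "i \<in> \<Psi>" and j: "j \<in> \<Psi>" and k: "k \<in> \<Psi>"
    and nz: "br (f i) (br (f j) Y) \<noteq> 0"
  shows "n k = (if k = i then 1 else 0) + (if k = j then 1 else 0)"
    and "br (h k) (br (f i) (br (f j) Y)) = sc (- n k) (br (f i) (br (f j) Y))"
proof -
  define d where "d l = (if k = l then 1 else 0 :: complex)" for l
  let ?W = "br (f i) (br (f j) Y)"
  have ef: "br (e k) (br (f l) X) = br (f l) (br (e k) X) + sc (d l) (br (h k) X)" if "l \<in> \<Psi>" for l X
    using br_br_left[of "e k" "f l" X] br_e_f_orth[OF k that] by (auto simp: d_def)
  have hf: "br (h k) (br (f l) X) = br (f l) (br (h k) X) - sc (2 * d l) (br (f l) X)"
    if "l \<in> \<Psi>" for l X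
    using br_br_left[of "h k" "f l" X] br_h_f[OF k that] by (auto simp: d_def br_linear algebra_simps)
  have ff: "br (f k) (br (f l) X) = br (f l) (br (f k) X)" if "l \<in> \<Psi>" for l X
    using that k by (intro br_commute_if br_mn_mn f_mn)
  have eY: "br (e k) Y = 0" using k Y by (intro br_mp_mp e_mp)
  have fY: "br (f j) Y \<in> \<kk>" using j Y by (intro br_mn_mp f_mn)
  have fW: "br (f k) ?W = 0" using i k fY by (intro br_mn_mn br_mn_kk f_mn)
  have efY: "br (e k) (br (f j) Y) = sc (d j * n k) Y"
    using j k by (simp add: ef eY n)
  have hfY: "br (h k) (br (f j) Y) = sc (n k - 2 * d j) (br (f j) Y)"
    using j k by (simp add: hf n br_linear scale_left_diff_distrib)
  have hW: "br (h k) ?W = sc (n k - 2 * d j - 2 * d i) ?W"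
    using i by (simp add: hf hfY br_linear scale_left_diff_distrib)
  have eW: "br (e k) ?W = sc (d j * n k) (br (f i) Y) + sc (d i * (n k - 2 * d j)) (br (f j) Y)"
    using i by (simp add: ef efY hfY br_linear)
  have "sc (d j) (br (f k) (br (f i) Y)) = sc (d j) ?W" "sc (d i) (br (f k) (br (f j) Y)) = sc (d i) ?W"
    using ff[OF i, of Y] by (auto simp: d_def)
  then have *: "sc (d j * c) (br (f k) (br (f i) Y)) = sc (d j * c) ?W"
      "sc (d i * c) (br (f k) (br (f j) Y)) = sc (d i * c) ?W" for c
    by (metis mult.commute scale_scale)+
  have "0 = br (e k) (br (f k) ?W)" by (simp add: fW)
  also have "\<dots> = br (f k) (br (e k) ?W) + br (h k) ?W"
    using ef[OF k, of ?W] by (simp add: d_def)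
  also have "\<dots> = sc (d j * n k + d i * (n k - 2 * d j) + (n k - 2 * d j - 2 * d i)) ?W"
    unfolding eW hW br_add_right br_scale_right * scale_left_distrib ..
  finally have "d j * n k + d i * (n k - 2 * d j) + (n k - 2 * d j - 2 * d i) = 0"
    using nz by simp
  \<comment> \<open>The equation reads
    \<open>(1 + d i + d j) * n k = 2 * (d i + d j + d i * d j)\<close>, and each \<open>d\<close> is
    0 or 1.\<close>
  then have nk: "n k = d i + d j"
    unfolding d_def by (auto split: if_splits)
  then show "n k = (if k = i then 1 else 0) + (if k = j then 1 else 0)" by (simp add: d_def)
  show "br (h k) ?W = sc (- n k) ?W"
    unfolding hW nk by simp
qed

section \<open>The antilinear operator and its square\<close>

definition E_sum :: "(('g \<Rightarrow> complex) \<Rightarrow> real) \<Rightarrow> 'g"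
  where "E_sum c = (\<Sum>\<psi>\<in>\<Psi>. sc (complex_of_real (c \<psi>)) (e \<psi>))"

definition H_sum :: "(('g \<Rightarrow> complex) \<Rightarrow> real) \<Rightarrow> 'g"
  where "H_sum c = (\<Sum>\<psi>\<in>\<Psi>. sc (complex_of_real (c \<psi>)) (h \<psi>))"

lemma \<sigma>_E_sum: "\<sigma> (E_sum c) = (\<Sum>\<psi>\<in>\<Psi>. sc (complex_of_real (c \<psi>)) (f \<psi>))"
  unfolding E_sum_def by (simp add: \<sigma>_sum \<sigma>_sc)

lemma \<sigma>_H_sum: "\<sigma> (H_sum c) = - H_sum c"
  unfolding H_sum_def by (simp add: \<sigma>_sum \<sigma>_sc \<sigma>_h sum_negf del: \<sigma>_br)

lemma E_sum_mp: "E_sum c \<in> \<mm>p" and H_sum_kk: "H_sum c \<in> \<kk>" and H_sum_t: "H_sum c \<in> t"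
  unfolding E_sum_def H_sum_def
  by (intro subspace_sum subspace_scale subspace_mp subspace_kk subspace_t e_mp h_kk h_t; assumption)+

lemma br_E_F: "br (E_sum a) (\<sigma> (E_sum b)) = H_sum (\<lambda>\<psi>. a \<psi> * b \<psi>)"
proof -
  have "(\<Sum>\<psi>'\<in>\<Psi>. sc (of_real (b \<psi>')) (sc (of_real (a \<psi>)) (br (e \<psi>) (f \<psi>'))))
      = sc (of_real (a \<psi> * b \<psi>)) (h \<psi>)" if "\<psi> \<in> \<Psi>" for \<psi>
  proof -
    have "(\<Sum>\<psi>'\<in>\<Psi>. sc (of_real (b \<psi>')) (sc (of_real (a \<psi>)) (br (e \<psi>) (f \<psi>'))))
      = (\<Sum>\<psi>'\<in>\<Psi>. if \<psi>' = \<psi> then sc (of_real (a \<psi> * b \<psi>)) (h \<psi>) else 0)"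
      using that by (intro sum.cong) (auto simp: br_e_f_orth mult.commute)
    then show ?thesis using that finite_\<Psi> by simp
  qed
  then show ?thesis
    unfolding \<sigma>_E_sum unfolding E_sum_def H_sum_def br_sum_left
    unfolding br_scale_left br_sum_right br_scale_right scale_sum_right
    by (intro sum.cong refl)
qed

lemma br_H_E: "br (H_sum a) (E_sum b) = sc 2 (E_sum (\<lambda>\<psi>. a \<psi> * b \<psi>))"
proof -
  have "(\<Sum>\<psi>'\<in>\<Psi>. sc (of_real (b \<psi>')) (sc (of_real (a \<psi>)) (br (h \<psi>) (e \<psi>'))))
      = sc (2 * of_real (a \<psi> * b \<psi>)) (e \<psi>)" if "\<psi> \<in> \<Psi>" for \<psi>
  proof -
    have "(\<Sum>\<psi>'\<in>\<Psi>. sc (of_real (b \<psi>')) (sc (of_real (a \<psi>)) (br (h \<psi>) (e \<psi>'))))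
      = (\<Sum>\<psi>'\<in>\<Psi>. if \<psi>' = \<psi> then sc (2 * of_real (a \<psi> * b \<psi>)) (e \<psi>) else 0)"
      using that by (intro sum.cong) (auto simp: br_h_e mult.commute mult.left_commute)
    then show ?thesis using that finite_\<Psi> by simp
  qed
  then show ?thesis
    unfolding E_sum_def H_sum_def br_sum_left
    unfolding br_scale_left br_sum_right br_scale_right scale_sum_right scale_scale[of 2]
    by (intro sum.cong refl)
qed

text \<open>For the coefficients of \<open>Z\<close> this is the antilinear operator
  \<open>C\<close> of the introduction.\<close>

definition E_twist :: "(('g \<Rightarrow> complex) \<Rightarrow> real) \<Rightarrow> 'g \<Rightarrow> 'g"
  where "E_twist c A = br (E_sum c) (br (E_sum c) (\<sigma> A))"

lemma E_twist_add: "E_twist c (A + B) = E_twist c A + E_twist c B"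
  and E_twist_diff: "E_twist c (A - B) = E_twist c A - E_twist c B"
  and E_twist_scale: "E_twist c (sc a A) = sc (cnj a) (E_twist c A)"
  unfolding E_twist_def by (simp_all add: \<sigma>_simps br_linear)

lemma \<sigma>_E_twist: "\<sigma> (E_twist c A) = br (\<sigma> (E_sum c)) (br (\<sigma> (E_sum c)) A)"
  unfolding E_twist_def by (simp add: \<sigma>_br)

lemma E_twist_mp: "A \<in> \<mm>p \<Longrightarrow> E_twist c A \<in> \<mm>p"
  unfolding E_twist_def by (intro br_mp_kk br_mp_mn \<sigma>_mp E_sum_mp)

text \<open>Since \<sigma> turns the inner operator into two brackets with \<open>q\<close>, the
  square is \<open>p p q q A\<close>. Moving each \<open>p\<close> to the right, where it kills
  \<open>A\<close>, leaves only commutators.\<close>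

lemma E_twist_twist:
  assumes A: "A \<in> \<mm>p"
  shows "E_twist c (E_twist c A) =
    sc 2 (br (H_sum (\<lambda>\<psi>. c \<psi> ^ 2)) (br (H_sum (\<lambda>\<psi>. c \<psi> ^ 2)) A) - br (H_sum (\<lambda>\<psi>. c \<psi> ^ 4)) A)"
proof -
  define p where "p = E_sum c"
  define q where "q = \<sigma> (E_sum c)"
  \<comment> \<open>Half of \<open>[H2, p]\<close>; its bracket with \<open>q\<close> is
    \<open>H4\<close>, the source of the fourth powers.\<close>
  define r where "r = E_sum (\<lambda>\<psi>. c \<psi> ^ 3)"
  define H2 where "H2 = H_sum (\<lambda>\<psi>. c \<psi> ^ 2)"
  define H4 where "H4 = H_sum (\<lambda>\<psi>. c \<psi> ^ 4)"
  have pq: "br p (br q X) = br q (br p X) + br H2 X" for X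
    using br_br_left[of p q X] br_E_F[of c c] unfolding p_def q_def H2_def
    by (simp add: power2_eq_square)
  have rq: "br r (br q X) = br q (br r X) + br H4 X" for X
    using br_br_left[of r q X] br_E_F[of "\<lambda>\<psi>. c \<psi> ^ 3" c] unfolding r_def q_def H4_def
    by (simp add: power_numeral_reduce mult_ac)
  have Hp: "br p (br H2 X) = br H2 (br p X) - sc 2 (br r X)" for X
    using br_br_left[of H2 p X] br_H_E[of "\<lambda>\<psi>. c \<psi> ^ 2" c] unfolding p_def H2_def r_def
    by (simp add: power_numeral_reduce br_linear mult_ac algebra_simps)
  have HA: "br H2 A \<in> \<mm>p"
    using A unfolding H2_def by (intro br_kk_mp H_sum_kk)
  have zero: "br p A = 0" "br r A = 0" "br p (br H2 A) = 0"
    using A HA unfolding p_def r_def by (auto intro: br_mp_mp E_sum_mp)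
  have "br p (br q (br q A)) = br q (br H2 A) + br H2 (br q A)"
    by (simp add: pq zero)
  then have "br p (br p (br q (br q A))) = br H2 (br H2 A) + (br H2 (br H2 A) - sc 2 (br H4 A))"
    by (simp add: br_linear pq Hp rq zero)
  also have "\<dots> = sc 2 (br H2 (br H2 A) - br H4 A)"
    by (simp add: sc_numeral_expand algebra_simps)
  finally show ?thesis
    unfolding E_twist_def[of c "E_twist c A"] \<sigma>_E_twist p_def q_def H2_def H4_def .
qed

lemma br_H_sum:
  assumes "\<And>\<psi>. \<psi> \<in> \<Psi> \<Longrightarrow> br (h \<psi>) Y = sc (n \<psi>) Y"
  shows "br (H_sum c) Y = sc (\<Sum>\<psi>\<in>\<Psi>. of_real (c \<psi>) * n \<psi>) Y"
  unfolding H_sum_def br_sum_left scale_sum_left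
  by (intro sum.cong) (simp_all add: br_scale_left assms)

text \<open>Applying \<sigma> turns \<open>E_twist c Y\<close> into a combination of the vectors
  \<open>f i f j Y\<close>. By \<open>ff_weight\<close> the nonzero ones have eigenvalue
  \<open>- s\<close>, and the sign is restored by \<sigma>, which negates
  \<open>H_sum\<close>.\<close>

lemma E_twist_weight_vector:
  assumes Y: "Y \<in> \<mm>p" "Y \<noteq> 0" "Y \<in> root_space sc br t \<beta>"
    and s: "br (H_sum (\<lambda>\<psi>. c \<psi> ^ 2)) Y = sc (of_real s) Y"
    and u: "br (H_sum (\<lambda>\<psi>. c \<psi> ^ 4)) Y = sc (of_real u) Y"
  shows "br (H_sum (\<lambda>\<psi>. c \<psi> ^ 2)) (E_twist c Y) = sc (of_real s) (E_twist c Y)"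
    and "u = s\<^sup>2 \<Longrightarrow> E_twist c Y = 0"
proof -
  let ?H = "H_sum (\<lambda>\<psi>. c \<psi> ^ 2)"
  define n where "n \<psi> = \<beta> (h \<psi>)" for \<psi>
  have n: "br (h \<psi>) Y = sc (n \<psi>) Y" if "\<psi> \<in> \<Psi>" for \<psi>
    using Y(3) h_t[OF that] unfolding root_space_def n_def by blast
  have s_eq: "of_real s = (\<Sum>\<psi>\<in>\<Psi>. of_real (c \<psi> ^ 2) * n \<psi>)"
    using br_H_sum[of Y n "\<lambda>\<psi>. c \<psi> ^ 2", OF n] s Y(2) by simp
  have u_eq: "of_real u = (\<Sum>\<psi>\<in>\<Psi>. of_real (c \<psi> ^ 4) * n \<psi>)"
    using br_H_sum[of Y n "\<lambda>\<psi>. c \<psi> ^ 4", OF n] u Y(2) by simp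
  define W where "W i j = br (f i) (br (f j) Y)" for i j
  have \<sigma>_twist: "\<sigma> (E_twist c Y) = (\<Sum>i\<in>\<Psi>. \<Sum>j\<in>\<Psi>. sc (of_real (c j * c i)) (W j i))"
    unfolding \<sigma>_E_twist \<sigma>_E_sum br_sum_left br_sum_right W_def
    by (intro sum.cong refl) (simp add: br_linear mult.commute)
  have HW: "br ?H (W i j) = sc (- of_real s) (W i j)" if "i \<in> \<Psi>" "j \<in> \<Psi>" for i j
  proof (cases "W i j = 0")
    case False
    have "br (h k) (W i j) = sc (- n k) (W i j)" if "k \<in> \<Psi>" for k
      using ff_weight(2)[OF Y(1) n \<open>i \<in> \<Psi>\<close> \<open>j \<in> \<Psi>\<close> that] False unfolding W_def by blast
    then have "br ?H (W i j) = sc (\<Sum>\<psi>\<in>\<Psi>. of_real (c \<psi> ^ 2) * (- n \<psi>)) (W i j)"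
      by (rule br_H_sum)
    then show ?thesis by (simp add: s_eq sum_negf)
  qed simp
  have "br ?H (\<sigma> (E_twist c Y)) = sc (- of_real s) (\<sigma> (E_twist c Y))"
    unfolding \<sigma>_twist br_sum_right scale_sum_right
    by (intro sum.cong refl) (simp add: br_linear HW mult.commute)
  then have "\<sigma> (br ?H (\<sigma> (E_twist c Y))) = \<sigma> (sc (- of_real s) (\<sigma> (E_twist c Y)))"
    by (rule arg_cong)
  then show "br ?H (E_twist c Y) = sc (of_real s) (E_twist c Y)"
    by (simp add: \<sigma>_br \<sigma>_sc \<sigma>_H_sum \<sigma>_minus br_linear)
  show "E_twist c Y = 0" if us: "u = s\<^sup>2"
  proof -
    have "sc (of_real (c i * c j)) (W i j) = 0" if ij: "i \<in> \<Psi>" "j \<in> \<Psi>" for i j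
    proof (cases "W i j = 0")
      case False
      have nk: "n k = (if k = i then 1 else 0) + (if k = j then 1 else 0)" if "k \<in> \<Psi>" for k
        using ff_weight(1)[OF Y(1) n ij that] False unfolding W_def by blast
      have val: "(\<Sum>\<psi>\<in>\<Psi>. of_real (a \<psi>) * n \<psi>) = of_real (a i + a j)" for a
      proof -
        have "(\<Sum>\<psi>\<in>\<Psi>. of_real (a \<psi>) * n \<psi>) =
            (\<Sum>\<psi>\<in>\<Psi>. (if \<psi> = i then of_real (a \<psi>) else 0) + (if \<psi> = j then of_real (a \<psi>) else 0))"
          by (intro sum.cong refl) (simp add: nk distrib_left)
        then show ?thesis using ij finite_\<Psi> by (simp add: sum.distrib)
      qed
      have "s = c i ^ 2 + c j ^ 2" "u = c i ^ 4 + c j ^ 4"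
        using s_eq u_eq unfolding val of_real_eq_iff by simp_all
      \<comment> \<open>The left side is \<open>s\<^sup>2 - u\<close>, also when
        \<open>i = j\<close>.\<close>
      then have "2 * (c i * c j) ^ 2 = 0"
        using us by (simp add: power2_eq_square power4_eq_xxxx algebra_simps)
      then show ?thesis by simp
    qed simp
    then have "\<sigma> (E_twist c Y) = 0" unfolding \<sigma>_twist by (intro sum.neutral ballI)
    then show ?thesis using \<sigma>_\<sigma>[of "E_twist c Y"] by simp
  qed
qed

section \<open>Joint eigenspaces of the two coroot sums\<close>

definition H_eigenspace :: "(('g \<Rightarrow> complex) \<Rightarrow> real) \<Rightarrow> real \<Rightarrow> real \<Rightarrow> 'g set"
  where "H_eigenspace c s u = {A \<in> \<mm>p. br (H_sum (\<lambda>\<psi>. c \<psi> ^ 2)) A = sc (of_real s) A \<and>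
    br (H_sum (\<lambda>\<psi>. c \<psi> ^ 4)) A = sc (of_real u) A}"

lemma subspace_H_eigenspace: "subspace (H_eigenspace c s u)"
  using subspace_mp unfolding subspace_def H_eigenspace_def
  by (auto simp: br_linear scale_right_distrib scale_left_commute)

lemma br_t_H_eigenspace:
  assumes "k \<in> t" "A \<in> H_eigenspace c s u" shows "br k A \<in> H_eigenspace c s u"
proof -
  have "br (H_sum a) (br k A) = br k (br (H_sum a) A)" for a
    using assms(1) by (intro br_commute_if br_t_t H_sum_t)
  then show ?thesis
    using assms t_in_k unfolding H_eigenspace_def by (auto simp: br_linear intro: br_kk_mp)
qed

lemma H_eigenspace_span_weight_vectors:
  "H_eigenspace c s u \<subseteq> span {Y \<in> H_eigenspace c s u. \<exists>\<beta>. Y \<in> root_space sc br t \<beta>}"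
  using toral_t subspace_H_eigenspace br_t_H_eigenspace by (rule toral_span_weight_vectors)

text \<open>Both conclusions cut out a complex subspace of vectors \<open>A\<close>, although
  \<open>E_twist\<close> is antilinear, so weight vectors suffice.\<close>

lemma E_twist_H_eigenspace:
  assumes "A \<in> H_eigenspace c s u"
  shows "br (H_sum (\<lambda>\<psi>. c \<psi> ^ 2)) (E_twist c A) = sc (of_real s) (E_twist c A)"
    and "u = s\<^sup>2 \<Longrightarrow> E_twist c A = 0"
proof -
  define G where "G = {A. br (H_sum (\<lambda>\<psi>. c \<psi> ^ 2)) (E_twist c A) = sc (of_real s) (E_twist c A) \<and>
    (u = s\<^sup>2 \<longrightarrow> E_twist c A = 0)}"
  have E0: "E_twist c 0 = 0" using E_twist_scale[of c 0 0] by simp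
  then have "subspace G"
    unfolding subspace_def G_def
    by (auto simp: E_twist_add E_twist_scale br_linear scale_right_distrib mult.commute)
  moreover have "Y \<in> G" if "Y \<in> H_eigenspace c s u" "Y \<in> root_space sc br t \<beta>" for Y \<beta>
  proof (cases "Y = 0")
    case False
    then show ?thesis
      using E_twist_weight_vector[of Y \<beta> c s u] that unfolding G_def H_eigenspace_def by blast
  qed (use E0 in \<open>simp add: G_def\<close>)
  ultimately have "span {Y \<in> H_eigenspace c s u. \<exists>\<beta>. Y \<in> root_space sc br t \<beta>} \<subseteq> G"
    by (intro span_minimal) auto
  then have "A \<in> G"
    using H_eigenspace_span_weight_vectors assms by blast
  then show "br (H_sum (\<lambda>\<psi>. c \<psi> ^ 2)) (E_twist c A) = sc (of_real s) (E_twist c A)"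
    "u = s\<^sup>2 \<Longrightarrow> E_twist c A = 0"
    unfolding G_def by auto
qed

text \<open>The eigenspace is spanned by weight vectors for \<open>t\<close>. The weight \<beta> of
  a nonzero one is a member of \<open>S\<close> itself, with \<open>weight_nonzero\<close> ensuring
  that its restriction to \<open>tm\<close> does not vanish.\<close>

lemma H_eigenspace_restricted_roots:
  fixes c :: "('g \<Rightarrow> complex) \<Rightarrow> real" and s u :: real
  defines "tm \<equiv> span (h ` \<Psi>)"
  defines "S \<equiv> {\<alpha>. restricted_root sc br t tm \<alpha> \<and> restricted_space sc br \<mm>p tm \<alpha> \<noteq> {0} \<and>
    \<alpha> (H_sum (\<lambda>\<psi>. c \<psi> ^ 2)) = of_real s \<and> \<alpha> (H_sum (\<lambda>\<psi>. c \<psi> ^ 4)) = of_real u}"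
  shows "H_eigenspace c s u = span (\<Union>\<alpha>\<in>S. restricted_space sc br \<mm>p tm \<alpha>)"
proof
  have H_tm: "H_sum a \<in> tm" for a
    unfolding tm_def H_sum_def by (intro span_sum span_scale span_base) auto
  have tm_t: "tm \<subseteq> t"
    unfolding tm_def using h_t by (intro span_minimal subspace_t) auto
  show "span (\<Union>\<alpha>\<in>S. restricted_space sc br \<mm>p tm \<alpha>) \<subseteq> H_eigenspace c s u"
    using H_tm by (intro span_minimal subspace_H_eigenspace)
      (auto simp: S_def restricted_space_def H_eigenspace_def)
  have "Y \<in> span (\<Union>\<alpha>\<in>S. restricted_space sc br \<mm>p tm \<alpha>)"
    if Y: "Y \<in> H_eigenspace c s u" "Y \<in> root_space sc br t \<beta>" for Y \<beta>
  proof (cases "Y = 0")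
    case False
    have Y_mp: "Y \<in> \<mm>p" using Y(1) unfolding H_eigenspace_def by blast
    have \<beta>: "br k Y = sc (\<beta> k) Y" if "k \<in> t" for k
      using Y(2) that unfolding root_space_def by blast
    note root = weight_nonzero[OF Y_mp False Y(2)]
    have "\<exists>k\<in>tm. \<beta> k \<noteq> 0"
      using root(2) unfolding tm_def by (auto intro: span_base)
    then have "restricted_root sc br t tm \<beta>"
      using root(1) unfolding restricted_root_def by blast
    moreover have Y_space: "Y \<in> restricted_space sc br \<mm>p tm \<beta>"
      using Y_mp \<beta> tm_t unfolding restricted_space_def by blast
    moreover have "\<beta> (H_sum (\<lambda>\<psi>. c \<psi> ^ 2)) = of_real s" "\<beta> (H_sum (\<lambda>\<psi>. c \<psi> ^ 4)) = of_real u"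
      using Y(1) False \<beta>[OF H_sum_t] unfolding H_eigenspace_def by auto
    ultimately have "\<beta> \<in> S"
      using False unfolding S_def by blast
    then show ?thesis using Y_space by (intro span_base) blast
  qed (simp add: span_zero)
  then have "span {Y \<in> H_eigenspace c s u. \<exists>\<beta>. Y \<in> root_space sc br t \<beta>} \<subseteq>
      span (\<Union>\<alpha>\<in>S. restricted_space sc br \<mm>p tm \<alpha>)"
    by (intro span_minimal) auto
  then show "H_eigenspace c s u \<subseteq> span (\<Union>\<alpha>\<in>S. restricted_space sc br \<mm>p tm \<alpha>)"
    using H_eigenspace_span_weight_vectors by blast
qed

lemma restricted_spaces_direct:
  fixes X :: "('g \<Rightarrow> complex) \<Rightarrow> 'g"
  assumes "finite F" "\<forall>\<alpha>\<in>F. \<forall>\<beta>\<in>F. \<alpha> \<noteq> \<beta> \<longrightarrow> (\<exists>k\<in>tm. \<alpha> k \<noteq> \<beta> k)"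
    and "\<forall>\<alpha>\<in>F. X \<alpha> \<in> restricted_space sc br P tm \<alpha>" and "(\<Sum>\<alpha>\<in>F. X \<alpha>) = 0"
  shows "\<forall>\<alpha>\<in>F. X \<alpha> = 0"
proof -
  have "\<forall>\<alpha>\<in>F. X \<alpha> \<in> {0}"
    by (rule weight_components_in_subspace[where H = tm and c = "\<lambda>\<alpha>. \<alpha>"])
      (use assms in \<open>auto simp: restricted_space_def subspace_def\<close>)
  then show ?thesis by simp
qed

end

section \<open>Joint eigenspaces\<close>

context orthogonal_triples
begin

abbreviation M0 where "M0 \<equiv> {A \<in> \<mm>. \<sigma> A = A}"

definition Z where "Z c = E_sum c + \<sigma> (E_sum c)"

text \<open>As \<open>p\<close> kills \<open>A\<close> and \<open>q\<close> kills
  \<open>\<sigma> A\<close>, four terms survive. For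
  \<open>br \<Upsilon> (Z c) = \<i> p - \<i> q\<close> the mixed terms keep their sign and the
  \<open>p p\<close> and \<open>q q\<close> terms change it.\<close>

lemma br_Z_br_Z:
  fixes c :: "('g \<Rightarrow> complex) \<Rightarrow> real"
  assumes A: "A \<in> \<mm>p"
  defines "H \<equiv> H_sum (\<lambda>\<psi>. c \<psi> ^ 2)"
  shows "br (Z c) (br (Z c) (A + \<sigma> A)) = (br H A + E_twist c A) + \<sigma> (br H A + E_twist c A)"
    and "br (br \<Upsilon> (Z c)) (br (br \<Upsilon> (Z c)) (A + \<sigma> A)) =
      (br H A - E_twist c A) + \<sigma> (br H A - E_twist c A)"
proof -
  define p where "p = E_sum c"
  define q where "q = \<sigma> (E_sum c)"
  have p: "p \<in> \<mm>p" and q: "q \<in> \<mm>m" unfolding p_def q_def by (intro E_sum_mp \<sigma>_mp)+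
  have \<sigma>pq: "\<sigma> p = q" "\<sigma> q = p" unfolding p_def q_def by simp_all
  have zero: "br p A = 0" "br q (\<sigma> A) = 0" using A p q by (auto intro: br_mp_mp br_mn_mn \<sigma>_mp)
  have pqA: "br p (br q A) = br H A"
    using br_br_left[of p q A] br_E_F[of c c] zero unfolding p_def q_def H_def
    by (simp add: power2_eq_square)
  have "\<sigma> (br p (br q A)) = br q (br p (\<sigma> A))" by (simp only: \<sigma>_br \<sigma>pq)
  then have qpA: "br q (br p (\<sigma> A)) = \<sigma> (br H A)" by (simp only: pqA)
  have ppA: "br p (br p (\<sigma> A)) = E_twist c A" unfolding E_twist_def p_def ..
  have qqA: "br q (br q A) = \<sigma> (E_twist c A)" unfolding \<sigma>_E_twist q_def ..
  have Z: "Z c = p + q" unfolding Z_def p_def q_def ..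
  have JZ: "br \<Upsilon> (Z c) = sc \<i> p - sc \<i> q" using p q by (simp add: Z br_add_right mpD mnD)
  show "br (Z c) (br (Z c) (A + \<sigma> A)) = (br H A + E_twist c A) + \<sigma> (br H A + E_twist c A)"
    unfolding Z by (simp add: br_linear zero pqA qpA ppA qqA \<sigma>_add algebra_simps)
  show "br (br \<Upsilon> (Z c)) (br (br \<Upsilon> (Z c)) (A + \<sigma> A)) =
      (br H A - E_twist c A) + \<sigma> (br H A - E_twist c A)"
    unfolding JZ by (simp add: br_linear zero pqA qpA ppA qqA \<sigma>_diff algebra_simps)
qed

text \<open>Both eigenvalue equations are compared in \<open>\<mm>p\<close> by
  \<open>add_\<sigma>_inject\<close>; half their sum and half their difference separate the linear
  part from the antilinear one.\<close>

lemma m0_joint_iff: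
  assumes A: "A \<in> \<mm>p"
  shows "A + \<sigma> A \<in> m0_joint sc br M0 (Z c) (br \<Upsilon> (Z c)) a b \<longleftrightarrow>
    br (H_sum (\<lambda>\<psi>. c \<psi> ^ 2)) A = sc (of_real ((a + b) / 2)) A \<and>
    E_twist c A = sc (of_real ((a - b) / 2)) A"
proof -
  let ?H = "H_sum (\<lambda>\<psi>. c \<psi> ^ 2)"
  have HA: "br ?H A \<in> \<mm>p" and CA: "E_twist c A \<in> \<mm>p"
    using A by (auto intro: br_kk_mp H_sum_kk E_twist_mp)
  have eq_iff: "G + \<sigma> G = sc (of_real r) (A + \<sigma> A) \<longleftrightarrow> G = sc (of_real r) A" if "G \<in> \<mm>p" for G r
    using add_\<sigma>_inject[OF that, of "sc (of_real r) A"] A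
    by (auto simp: \<sigma>_sc scale_right_distrib subspace_scale subspace_mp)
  have "A + \<sigma> A \<in> M0"
    using subspace_add[OF subspace_mm mpD(2)[OF A] \<sigma>_mm[OF mpD(2)[OF A]]]
    by (simp add: \<sigma>_add add.commute)
  then have "A + \<sigma> A \<in> m0_joint sc br M0 (Z c) (br \<Upsilon> (Z c)) a b \<longleftrightarrow>
      br ?H A + E_twist c A = sc (of_real a) A \<and> br ?H A - E_twist c A = sc (of_real b) A"
    unfolding m0_joint_def mem_Collect_eq br_Z_br_Z[OF A]
    using eq_iff[of "br ?H A + E_twist c A" a] eq_iff[of "br ?H A - E_twist c A" b]
      subspace_add[OF subspace_mp HA CA] subspace_diff[OF subspace_mp HA CA] by simp
  also have "\<dots> \<longleftrightarrow> br ?H A = sc (of_real ((a + b) / 2)) A \<and>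
      E_twist c A = sc (of_real ((a - b) / 2)) A"
  proof (intro iffI conjI; elim conjE)
    assume *: "br ?H A + E_twist c A = sc (of_real a) A" "br ?H A - E_twist c A = sc (of_real b) A"
    have "br ?H A + br ?H A = sc (of_real (a + b)) A"
      using * by (simp add: scale_left_distrib flip: *)
    then show "br ?H A = sc (of_real ((a + b) / 2)) A"
      using half_double[of "br ?H A"] by simp
    have "E_twist c A + E_twist c A = sc (of_real (a - b)) A"
      using * by (simp add: scale_left_diff_distrib flip: *)
    then show "E_twist c A = sc (of_real ((a - b) / 2)) A"
      using half_double[of "E_twist c A"] by simp
  next
    assume *: "br ?H A = sc (of_real ((a + b) / 2)) A" "E_twist c A = sc (of_real ((a - b) / 2)) A"
    show "br ?H A + E_twist c A = sc (of_real a) A"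
      unfolding * scale_left_distrib[symmetric] of_real_add[symmetric]
      by (rule arg_cong[where f = "\<lambda>r. sc (of_real r) A"]) (simp add: field_simps)
    show "br ?H A - E_twist c A = sc (of_real b) A"
      unfolding * scale_left_diff_distrib[symmetric] of_real_diff[symmetric]
      by (rule arg_cong[where f = "\<lambda>r. sc (of_real r) A"]) (simp add: field_simps)
  qed
  finally show ?thesis .
qed

lemma m0_joint_obtain:
  assumes "A \<in> m0_joint sc br M0 z jz a b"
  obtains B where "B \<in> \<mm>p" "A = B + \<sigma> B"
proof -
  have "A \<in> \<mm>" "\<sigma> A = A" using assms unfolding m0_joint_def by auto
  then show ?thesis using mm_decomposition[of A] that by metis
qed

text \<open>With \<open>s = (\<nu>1 + \<nu>2) / 2\<close> and \<open>d = (\<nu>1 - \<nu>2) / 2\<close>, the \<open>\<mm>p\<close> parts of both summands of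
  \<open>m0_nu\<close> satisfy \<open>D = s\<close> and \<open>C\<^sup>2 = d\<^sup>2\<close> for \<open>C = E_twist c\<close>, hence
  \<open>D' = s\<^sup>2 - d\<^sup>2 / 2\<close>. Conversely \<open>A\<close> is the sum of \<open>(A \<plusminus> C A / d) / 2\<close> if \<open>d \<noteq> 0\<close>, and \<open>C A = 0\<close> otherwise.\<close>
lemma m0_nu_H_eigenspace:
  "{A \<in> \<mm>p. A + \<sigma> A \<in> m0_nu sc br M0 (Z c) (br \<Upsilon> (Z c)) \<nu>1 \<nu>2} =
    H_eigenspace c ((\<nu>1 + \<nu>2) / 2) ((\<nu>1^2 + 6 * \<nu>1 * \<nu>2 + \<nu>2^2) / 8)"
  (is "?L = H_eigenspace c ?s ?u")
proof
  let ?H = "H_sum (\<lambda>\<psi>. c \<psi> ^ 2)"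
  define d where "d = (\<nu>1 - \<nu>2) / 2"
  have u: "?u = ?s\<^sup>2 - d\<^sup>2 / 2"
    unfolding d_def by (simp add: power2_eq_square field_simps)
  have joint: "B \<in> H_eigenspace c ?s ?u"
    if B: "B \<in> \<mm>p" "B + \<sigma> B \<in> m0_joint sc br M0 (Z c) (br \<Upsilon> (Z c)) a b"
      and ab: "a + b = \<nu>1 + \<nu>2" "((a - b) / 2)\<^sup>2 = d\<^sup>2" for B a b
  proof -
    let ?r = "(a - b) / 2"
    have HB: "br ?H B = sc (of_real ?s) B" and CB: "E_twist c B = sc (of_real ?r) B"
      using B(2) unfolding m0_joint_iff[OF B(1)] ab(1) by blast+
    \<comment> \<open>Antilinearity gives \<open>cnj ?r * ?r\<close>, which is the square because
      \<open>?r\<close> is real.\<close>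
    have "E_twist c (E_twist c B) = sc (of_real (d\<^sup>2)) B"
      unfolding CB E_twist_scale scale_scale ab(2)[symmetric]
      by (simp only: complex_cnj_complex_of_real of_real_mult[symmetric] power2_eq_square)
    then have "sc 2 (br ?H (br ?H B) - br (H_sum (\<lambda>\<psi>. c \<psi> ^ 4)) B) = sc (of_real (d\<^sup>2)) B"
      unfolding E_twist_twist[OF B(1)] .
    then have "sc (1 / 2) (sc 2 (br ?H (br ?H B) - br (H_sum (\<lambda>\<psi>. c \<psi> ^ 4)) B)) =
        sc (1 / 2) (sc (of_real (d\<^sup>2)) B)" by (rule arg_cong)
    then have "br ?H (br ?H B) - br (H_sum (\<lambda>\<psi>. c \<psi> ^ 4)) B = sc (of_real (d\<^sup>2 / 2)) B"
      by simp
    moreover have "br ?H (br ?H B) = sc (of_real (?s\<^sup>2)) B"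
      unfolding HB br_scale_right scale_scale
      by (simp only: of_real_mult[symmetric] power2_eq_square)
    ultimately have "br (H_sum (\<lambda>\<psi>. c \<psi> ^ 4)) B = sc (of_real (?s\<^sup>2)) B - sc (of_real (d\<^sup>2 / 2)) B"
      by (simp only: diff_eq_eq eq_diff_eq add.commute)
    then have "br (H_sum (\<lambda>\<psi>. c \<psi> ^ 4)) B = sc (of_real ?u) B"
      unfolding u of_real_diff scale_left_diff_distrib .
    then show ?thesis using B(1) HB unfolding H_eigenspace_def by blast
  qed
  show "?L \<subseteq> H_eigenspace c ?s ?u"
  proof
    fix A assume "A \<in> ?L"
    then obtain A1 A2 where A: "A \<in> \<mm>p" "A + \<sigma> A = A1 + A2"
      and A1: "A1 \<in> m0_joint sc br M0 (Z c) (br \<Upsilon> (Z c)) \<nu>1 \<nu>2"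
      and A2: "A2 \<in> m0_joint sc br M0 (Z c) (br \<Upsilon> (Z c)) \<nu>2 \<nu>1"
      unfolding m0_nu_def by blast
    obtain B1 where B1: "B1 \<in> \<mm>p" "A1 = B1 + \<sigma> B1" using A1 by (rule m0_joint_obtain)
    obtain B2 where B2: "B2 \<in> \<mm>p" "A2 = B2 + \<sigma> B2" using A2 by (rule m0_joint_obtain)
    have "A + \<sigma> A = (B1 + B2) + \<sigma> (B1 + B2)"
      using A(2) unfolding B1(2) B2(2) \<sigma>_add by (simp only: add_ac)
    then have "A = B1 + B2"
      by (rule add_\<sigma>_inject[OF A(1) subspace_add[OF subspace_mp B1(1) B2(1)]])
    moreover have "B1 \<in> H_eigenspace c ?s ?u"
      using B1 A1 by (intro joint[of B1 \<nu>1 \<nu>2]) (simp_all add: d_def)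
    moreover have "B2 \<in> H_eigenspace c ?s ?u"
      using B2 A2 by (intro joint[of B2 \<nu>2 \<nu>1]) (simp_all add: d_def power2_commute power_divide)
    ultimately show "A \<in> H_eigenspace c ?s ?u"
      using subspace_add[OF subspace_H_eigenspace] by blast
  qed
  show "H_eigenspace c ?s ?u \<subseteq> ?L"
  proof
    fix A assume A: "A \<in> H_eigenspace c ?s ?u"
    then have A_mp: "A \<in> \<mm>p" and HA: "br ?H A = sc (of_real ?s) A"
      and KA: "br (H_sum (\<lambda>\<psi>. c \<psi> ^ 4)) A = sc (of_real ?u) A"
      unfolding H_eigenspace_def by auto
    have d': "d = (\<nu>1 - \<nu>2) / 2" "- d = (\<nu>2 - \<nu>1) / 2" "?s = (\<nu>2 + \<nu>1) / 2"
      by (simp_all add: d_def field_simps)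
    have HC: "br ?H (E_twist c A) = sc (of_real ?s) (E_twist c A)"
      using A by (rule E_twist_H_eigenspace)
    \<comment> \<open>This vector is normalized so that \<open>E_twist c\<close> exchanges
      \<open>A\<close> and \<open>C\<close> up to the factor \<open>d\<close>, making
      \<open>A + C\<close> and \<open>A - C\<close> eigenvectors. For \<open>d = 0\<close> the
      operator kills \<open>A\<close>, and \<open>C = A\<close> leaves
      \<open>A2 = 0\<close>.\<close>
    define C where "C = (if d = 0 then A else sc (of_real (1 / d)) (E_twist c A))"
    have CA: "E_twist c A = sc (of_real d) C"
      using E_twist_H_eigenspace(2)[OF A] u unfolding C_def by simp
    have C: "C \<in> \<mm>p" "br ?H C = sc (of_real ?s) C"
      unfolding C_def using A_mp HA HC
      by (auto simp: br_scale_right scale_left_commute intro: subspace_scale subspace_mp E_twist_mp)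
    have CC: "E_twist c C = sc (of_real d) A"
    proof (cases "d = 0")
      case True
      then show ?thesis using CA by (simp add: C_def)
    next
      case False
      have "E_twist c (E_twist c A) = sc 2 (sc (of_real (?s\<^sup>2)) A - sc (of_real ?u) A)"
        unfolding E_twist_twist[OF A_mp] HA KA br_scale_right scale_scale
        by (simp add: power2_eq_square)
      also have "\<dots> = sc (of_real (2 * (?s\<^sup>2 - ?u))) A"
        by (simp only: scale_left_diff_distrib[symmetric] scale_scale of_real_mult of_real_diff of_real_numeral)
      also have "2 * (?s\<^sup>2 - ?u) = d * d" unfolding u by (simp add: power2_eq_square)
      finally show ?thesis using False by (simp add: C_def E_twist_scale)
    qed
    define A1 where "A1 = sc (1 / 2) (A + C)"
    define A2 where "A2 = sc (1 / 2) (A - C)"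
    have mp: "A1 \<in> \<mm>p" "A2 \<in> \<mm>p"
      unfolding A1_def A2_def using A_mp C(1)
      by (auto intro: subspace_scale subspace_add subspace_diff subspace_mp)
    have H12: "br ?H A1 = sc (of_real ?s) A1" "br ?H A2 = sc (of_real ?s) A2"
      unfolding A1_def A2_def
      by (simp_all only: br_linear HA C(2) scale_right_distrib scale_right_diff_distrib scale_left_commute)
    have C12: "E_twist c A1 = sc (of_real d) A1" "E_twist c A2 = sc (of_real (- d)) A2"
      unfolding A1_def A2_def
      by (simp_all add: E_twist_scale E_twist_add E_twist_diff CA CC scale_right_distrib
          scale_right_diff_distrib mult.commute)
    have "A1 + \<sigma> A1 \<in> m0_joint sc br M0 (Z c) (br \<Upsilon> (Z c)) \<nu>1 \<nu>2"
      unfolding m0_joint_iff[OF mp(1)] using H12 C12 d' by simp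
    moreover have "A2 + \<sigma> A2 \<in> m0_joint sc br M0 (Z c) (br \<Upsilon> (Z c)) \<nu>2 \<nu>1"
      unfolding m0_joint_iff[OF mp(2)] using H12(2) C12(2) unfolding d'(2,3) by blast
    moreover have "A = A1 + A2"
      unfolding A1_def A2_def using half_double[of A] by (simp add: algebra_simps)
    then have "A + \<sigma> A = (A1 + \<sigma> A1) + (A2 + \<sigma> A2)" by (simp add: \<sigma>_add add_ac)
    ultimately show "A \<in> ?L"
      using A_mp unfolding m0_nu_def by blast
  qed
qed

end

text \<open>Roots are functions on all of \<open>'g\<close>, so different members of
  \<open>S\<close> may agree on \<open>tm\<close> and have the same restricted space. Directness is
  therefore stated for finite families that are pairwise distinct on \<open>tm\<close>.\<close>

theorem theorem5p3:
  fixes sc :: "complex \<Rightarrow> 'g::ab_group_add \<Rightarrow> 'g"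
    and br :: "'g \<Rightarrow> 'g \<Rightarrow> 'g"
    and \<sigma> \<theta> :: "'g \<Rightarrow> 'g"
    and \<Upsilon> :: 'g
    and t :: "'g set"
    and \<Psi> :: "('g \<Rightarrow> complex) set"
    and e :: "('g \<Rightarrow> complex) \<Rightarrow> 'g"
    and lam :: "('g \<Rightarrow> complex) \<Rightarrow> real"
    and \<nu>1 \<nu>2 :: real
  assumes herm: "hermitian_setup sc br \<sigma> \<theta> \<Upsilon>"
    and cartan: "cartan_subalgebra sc br t"
    and t_in_k: "t \<subseteq> kk \<sigma> \<theta>"
    and t_theta: "\<forall>h\<in>t. \<theta> h \<in> t"
    and Psi: "max_strongly_orthogonal_set sc br t (mplus sc br \<sigma> \<theta> \<Upsilon>) \<Psi>"
    and e_root: "\<forall>\<psi>\<in>\<Psi>. e \<psi> \<in> root_space sc br t \<psi> \<and> e \<psi> \<noteq> 0"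
    and sl2_e: "\<forall>\<psi>\<in>\<Psi>. br (br (e \<psi>) (\<sigma> (e \<psi>))) (e \<psi>) = sc 2 (e \<psi>)"
    and sl2_f: "\<forall>\<psi>\<in>\<Psi>. br (br (e \<psi>) (\<sigma> (e \<psi>))) (\<sigma> (e \<psi>)) = sc (- 2) (\<sigma> (e \<psi>))"
  shows
    "let h = (\<lambda>\<psi>. br (e \<psi>) (\<sigma> (e \<psi>)));
         x = (\<lambda>\<psi>. e \<psi> + \<sigma> (e \<psi>));
         tm = module.span sc (h ` \<Psi>);
         P = mplus sc br \<sigma> \<theta> \<Upsilon>;
         M0 = {A \<in> mm \<sigma> \<theta>. \<sigma> A = A};
         Z = (\<Sum>\<psi>\<in>\<Psi>. sc (complex_of_real (lam \<psi>)) (x \<psi>));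
         JZ = br \<Upsilon> Z;
         Pnu = {A \<in> P. A + \<sigma> A \<in> m0_nu sc br M0 Z JZ \<nu>1 \<nu>2};
         S = {\<alpha>. restricted_root sc br t tm \<alpha> \<and> restricted_space sc br P tm \<alpha> \<noteq> {0} \<and>
                 \<alpha> (\<Sum>\<psi>\<in>\<Psi>. sc (complex_of_real ((lam \<psi>)^2)) (h \<psi>)) = complex_of_real ((\<nu>1 + \<nu>2) / 2) \<and>
                 \<alpha> (\<Sum>\<psi>\<in>\<Psi>. sc (complex_of_real ((lam \<psi>)^4)) (h \<psi>))
                   = complex_of_real ((\<nu>1^2 + 6 * \<nu>1 * \<nu>2 + \<nu>2^2) / 8)}
     in Pnu = module.span sc (\<Union>\<alpha>\<in>S. restricted_space sc br P tm \<alpha>) \<and>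
        (\<forall>F X. finite F \<and> F \<subseteq> S \<and>
               (\<forall>\<alpha>\<in>F. \<forall>\<beta>\<in>F. \<alpha> \<noteq> \<beta> \<longrightarrow> (\<exists>h\<in>tm. \<alpha> h \<noteq> \<beta> h)) \<and>
               (\<forall>\<alpha>\<in>F. X \<alpha> \<in> restricted_space sc br P tm \<alpha>) \<and> (\<Sum>\<alpha>\<in>F. X \<alpha>) = 0
               \<longrightarrow> (\<forall>\<alpha>\<in>F. X \<alpha> = 0))"
proof -
  interpret orthogonal_triples sc br \<sigma> \<theta> \<Upsilon> t \<Psi> e
    using assms by unfold_locales
  have Z_eq: "(\<Sum>\<psi>\<in>\<Psi>. sc (complex_of_real (lam \<psi>)) (e \<psi> + \<sigma> (e \<psi>))) = Z lam"
    unfolding Z_def \<sigma>_E_sum unfolding E_sum_def by (simp add: scale_right_distrib sum.distrib)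
  show ?thesis
    unfolding Let_def Z_eq m0_nu_H_eigenspace H_sum_def[symmetric]
  proof (intro conjI allI impI; (elim conjE)?)
    fix F X
    assume "finite F" "\<forall>\<alpha>\<in>F. \<forall>\<beta>\<in>F. \<alpha> \<noteq> \<beta> \<longrightarrow> (\<exists>h\<in>span (h ` \<Psi>). \<alpha> h \<noteq> \<beta> h)"
      "\<forall>\<alpha>\<in>F. X \<alpha> \<in> restricted_space sc br \<mm>p (span (h ` \<Psi>)) \<alpha>" "(\<Sum>\<alpha>\<in>F. X \<alpha>) = 0"
    then show "\<forall>\<alpha>\<in>F. X \<alpha> = 0" by (rule restricted_spaces_direct)
  qed (rule H_eigenspace_restricted_roots)
qed

end
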